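(* Let $(\rho(\theta))_{\theta\in\mathbb{R}^L}$ be a second-order differentiable family of positive definite states on a finite-dimensional Hilbert space. For all $\alpha\in(0,1)$, the following integral representation holds for the sandwiched Rényi information matrix: $$[\widetilde I_\alpha(\theta)]_{i,j}=\frac{\sin((1-\alpha)\pi)}{(1-\alpha)\pi}\int_0^\infty dt\; t^{1-\alpha}\,\mathrm{Tr}\left[\left(\rho(\theta)^{\frac1\alpha}+tI\right)^{-1}(\partial_i\rho(\theta))\left(\rho(\theta)^{\frac1\alpha}+tI\right)^{-1}(\partial_j\rho(\theta))\right],$$ where $\partial_i=\frac{\partial}{\partial\theta_i}$ and $I$ is the identity operator.
   Context: A state is a positive semi-definite operator of unit trace. For positive definite states $\rho,\sigma$ and $\alpha\in(0,1)\cup(1,\infty)$, the sandwiched Rényi relative entropy is $\widetilde D_\alpha(\rho\|\sigma):=\frac{1}{\alpha-1}\ln\mathrm{Tr}\big[(\sigma^{\frac{1-\alpha}{2\alpha}}\rho\,\sigma^{\frac{1-\alpha}{2\alpha}})^\alpha\big]$. The sandwiched Rényi information matrix has entries $[\widetilde I_\alpha(\theta)]_{i,j}:=\frac1\alpha\left.\frac{\partial^2}{\partial\varepsilon_i\partial\varepsilon_j}\widetilde D_\alpha(\rho(\theta)\|\rho(\theta+\varepsilon))\right|_{\varepsilon=0}$. *)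

theory Defs
  imports "HOL-Analysis.Analysis"
begin

(* Operators on a finite-dimensional Hilbert space are complex 'n x 'n matrices. *)

definition mat_adjoint :: "complex^'n^'m \<Rightarrow> complex^'m^'n" where
  "mat_adjoint A = (\<chi> i j. cnj (A $ j $ i))"

definition cinner :: "complex^'n \<Rightarrow> complex^'n \<Rightarrow> complex" where
  "cinner x y = (\<Sum>i\<in>UNIV. cnj (x $ i) * y $ i)"

definition hermitian_mat :: "complex^'n^'n \<Rightarrow> bool" where
  "hermitian_mat A \<longleftrightarrow> mat_adjoint A = A"

definition unitary_mat :: "complex^'n^'n \<Rightarrow> bool" where
  "unitary_mat U \<longleftrightarrow> mat_adjoint U ** U = mat 1 \<and> U ** mat_adjoint U = mat 1"

(* For Hermitian A, the number cinner x (A *v x) is real. *)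

definition pos_semidef :: "complex^'n^'n \<Rightarrow> bool" where
  "pos_semidef A \<longleftrightarrow> hermitian_mat A \<and> (\<forall>x. Re (cinner x (A *v x)) \<ge> 0)"

definition pos_def :: "complex^'n^'n \<Rightarrow> bool" where
  "pos_def A \<longleftrightarrow> hermitian_mat A \<and> (\<forall>x. x \<noteq> 0 \<longrightarrow> Re (cinner x (A *v x)) > 0)"

definition quantum_state :: "complex^'n^'n \<Rightarrow> bool" where
  "quantum_state A \<longleftrightarrow> pos_semidef A \<and> trace A = 1"

definition diag_mat :: "('n \<Rightarrow> real) \<Rightarrow> complex^'n^'n" where
  "diag_mat d = (\<chi> i j. if i = j then complex_of_real (d i) else 0)"

(* Spectral functional calculus: B has the eigenvectors of A, with each eigenvalue d k
   replaced by d k powr p.  B does not depend on the diagonalisation chosen. Only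
   meaningful for positive definite A, because powr is unsuitable at nonpositive bases. *)

definition mat_powr :: "complex^'n^'n \<Rightarrow> real \<Rightarrow> complex^'n^'n" where
  "mat_powr A p = (THE B. \<exists>U d. unitary_mat U \<and>
     A = U ** diag_mat d ** mat_adjoint U \<and>
     B = U ** diag_mat (\<lambda>k. d k powr p) ** mat_adjoint U)"

(* For positive definite arguments the trace below is real and positive, so taking Re
   loses nothing. *)

definition sandwiched_renyi :: "real \<Rightarrow> complex^'n^'n \<Rightarrow> complex^'n^'n \<Rightarrow> real" where
  "sandwiched_renyi \<alpha> \<rho> \<sigma> =
     1 / (\<alpha> - 1) *
     ln (Re (trace (mat_powr
       (mat_powr \<sigma> ((1 - \<alpha>) / (2 * \<alpha>)) ** \<rho> ** mat_powr \<sigma> ((1 - \<alpha>) / (2 * \<alpha>))) \<alpha>)))"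

definition partial_deriv :: "'l \<Rightarrow> (real^'l \<Rightarrow> 'b::real_normed_vector) \<Rightarrow> real^'l \<Rightarrow> 'b" where
  "partial_deriv i f x = vector_derivative (\<lambda>s. f (x + s *\<^sub>R axis i 1)) (at 0)"

definition twice_differentiable :: "('a::real_normed_vector \<Rightarrow> 'b::real_normed_vector) \<Rightarrow> bool" where
  "twice_differentiable f \<longleftrightarrow>
     (\<exists>f' :: 'a \<Rightarrow> 'a \<Rightarrow>\<^sub>L 'b. \<forall>x. (f has_derivative blinfun_apply (f' x)) (at x) \<and>
                                 f' differentiable (at x))"

definition sandwiched_renyi_info ::
  "real \<Rightarrow> (real^'l \<Rightarrow> complex^'n^'n) \<Rightarrow> real^'l \<Rightarrow> real^'l^'l" where
  "sandwiched_renyi_info \<alpha> \<rho> \<theta> = (\<chi> i j.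
     1 / \<alpha> * partial_deriv i
       (partial_deriv j (\<lambda>\<epsilon>. sandwiched_renyi \<alpha> (\<rho> \<theta>) (\<rho> (\<theta> + \<epsilon>)))) 0)"

end

theory Submission
  imports Defs "HOL-Real_Asymp.Real_Asymp"
begin

text \<open>With \<open>r = (1 - \<alpha>) / (2 \<alpha>)\<close>, \<open>T = \<sigma>\<^sup>r\<close> and \<open>N = (T \<rho> T)\<^bsup>\<alpha>-1\<^esup>\<close>, a derivative of
  \<open>Tr (T \<rho> T)\<^sup>\<alpha>\<close> in \<open>\<sigma>\<close> is \<open>\<alpha> Tr [(\<rho> T N + N T \<rho>) T']\<close>. Since
  \<open>Tr [\<sigma>\<^bsup>1-r\<^esup> T'] = r Tr \<sigma>' = 0\<close>, one may subtract \<open>2 \<sigma>\<^bsup>1-r\<^esup>\<close> from the first factor, which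
  then vanishes at \<open>\<sigma> = \<rho>\<close>. The second derivative at \<open>\<rho>\<close> therefore needs only the first
  derivatives of matrix powers, which are double operator integrals of divided differences
  (Daleckii--Krein). In an eigenbasis of \<open>\<rho>\<close> the result is a Schur multiplier, equal to the divided
  difference of \<open>x\<^bsup>1-\<alpha>\<^esup>\<close> at the eigenvalues of \<open>\<rho>\<^bsup>1/\<alpha>\<^esup>\<close>, and a Beta integral turns that
  divided difference into an integral over resolvents.\<close>

section \<open>The spectral theorem for Hermitian matrices\<close>

text \<open>Eigenvectors of a moving matrix need not depend continuously on it, so no
  diagonalisation is ever differentiated. A double operator integral does not depend on the
  eigenbases chosen, and this gives an exact difference formula for two different matrices,
  \<open>mat_fun f A - mat_fun f B = dop (divdiff f f') A B (A - B)\<close>; derivatives then follow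
  from joint continuity in \<open>A\<close> and \<open>B\<close>. The vanishing gradient matters
  because the first derivative has the form \<open>Tr [G Y]\<close>, where \<open>Y\<close> contains
  the derivative of a matrix power at the moving point. Where \<open>G\<close> is zero, the product
  rule asks only for continuity of \<open>Y\<close>, and no second derivative of a matrix power
  appears. The exponents rest on \<open>1 / \<alpha> = 1 + 2 r\<close>: at
  \<open>\<sigma> = \<rho>\<close> the sandwich \<open>T \<rho> T\<close> is the power
  \<open>1 / \<alpha>\<close> of \<rho>, which is the operator in the resolvents. The multiplier of
  the second derivative is minus the divided difference, and this sign meets the negative prefactor
  \<open>1 / (\<alpha> - 1)\<close>.\<close>

lemma mat_adjoint_mult: "mat_adjoint (A ** B) = mat_adjoint B ** mat_adjoint A"
  by (simp add: mat_adjoint_def matrix_matrix_mult_def vec_eq_iff mult.commute)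

lemma mat_adjoint_adjoint [simp]: "mat_adjoint (mat_adjoint A) = A"
  by (simp add: mat_adjoint_def vec_eq_iff)

lemma mat_adjoint_diag [simp]: "mat_adjoint (diag_mat d) = diag_mat d"
  by (simp add: mat_adjoint_def diag_mat_def vec_eq_iff)

lemma diag_mat_mult_left: "(diag_mat d ** A) $ i $ j = complex_of_real (d i) * A $ i $ j"
  by (simp add: diag_mat_def matrix_matrix_mult_def if_distrib[of "\<lambda>x. x * _"] cong: if_cong)

lemma diag_mat_mult_right: "(A ** diag_mat d) $ i $ j = A $ i $ j * complex_of_real (d j)"
  by (simp add: diag_mat_def matrix_matrix_mult_def if_distrib[of "\<lambda>x. _ * x"] cong: if_cong)

lemma inner_eq_Re_cinner: "inner x y = Re (cinner x y)"
  by (simp add: inner_vec_def cinner_def inner_complex_def)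

lemma cinner_mult_vec: "cinner x (A *v y) = cinner (mat_adjoint A *v x) y"
proof -
  have "cinner x (A *v y) = (\<Sum>i\<in>UNIV. \<Sum>j\<in>UNIV. cnj (x $ i) * (A $ i $ j * y $ j))"
    by (simp add: cinner_def matrix_vector_mult_def sum_distrib_left)
  also have "\<dots> = (\<Sum>j\<in>UNIV. \<Sum>i\<in>UNIV. cnj (x $ i) * (A $ i $ j * y $ j))"
    by (rule sum.swap)
  also have "\<dots> = cinner (mat_adjoint A *v x) y"
    by (simp add: cinner_def matrix_vector_mult_def mat_adjoint_def sum_distrib_right sum_distrib_left mult_ac)
  finally show ?thesis .
qed

lemma cinner_commute: "cinner x y = cnj (cinner y x)"
  by (simp add: cinner_def mult.commute)

lemma cinner_add_right: "cinner x (y + z) = cinner x y + cinner x z"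
  by (simp add: cinner_def ring_distribs sum.distrib)

lemma cinner_diff_right: "cinner x (y - z) = cinner x y - cinner x z"
  by (simp add: cinner_def ring_distribs sum_subtractf)

lemma cinner_scaleR_right: "cinner x (c *\<^sub>R y) = of_real c * cinner x y"
  unfolding cinner_def sum_distrib_left vector_scaleR_component by (simp add: scaleR_conv_of_real mult_ac)

lemma cinner_scaleR_left: "cinner (c *\<^sub>R x) y = of_real c * cinner x y"
  unfolding cinner_def sum_distrib_left vector_scaleR_component by (simp add: scaleR_conv_of_real mult_ac)

lemma mat_vec_scaleR: "(A :: complex^'n^'m) *v (c *\<^sub>R x) = c *\<^sub>R (A *v x)"
  unfolding vec_eq_iff matrix_vector_mult_def vector_scaleR_component
  by (simp add: scaleR_conv_of_real sum_distrib_left mult_ac vector_scaleR_component)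

lemma cinner_self: "cinner x x = of_real ((norm x)\<^sup>2)"
proof -
  have "Im (cinner x x) = 0"
    using arg_cong[OF cinner_commute[of x x], of Im] by simp
  moreover have "Re (cinner x x) = (norm x)\<^sup>2"
    by (metis inner_eq_Re_cinner power2_norm_eq_inner)
  ultimately show ?thesis
    by (simp add: complex_eq_iff)
qed

lemma hermitian_inner_commute:
  assumes "hermitian_mat A"
  shows "inner x (A *v y) = inner (A *v x) y"
  using assms by (simp add: inner_eq_Re_cinner cinner_mult_vec hermitian_mat_def)

text \<open>The dimension count is over the reals, where the space has dimension twice
  \<open>CARD('n)\<close>. Real orthogonality to both \<open>v\<close> and \<open>\<i> v\<close> is
  complex orthogonality to \<open>v\<close>, so each vector of \<open>S\<close> costs two real
  dimensions.\<close>

lemma exists_orthogonal_vector: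
  fixes S :: "(complex^'n) set"
  assumes "finite S" "card S < CARD('n)"
  shows "\<exists>x. x \<noteq> 0 \<and> (\<forall>v\<in>S. cinner v x = 0)"
proof -
  define J where "J = (\<lambda>v::complex^'n. \<chi> i. \<i> * v $ i)"
  have "dim (S \<union> J ` S) \<le> card (S \<union> J ` S)"
    using assms by (intro dim_le_card') auto
  also have "\<dots> \<le> card S + card (J ` S)" by (rule card_Un_le)
  also have "\<dots> \<le> 2 * card S" using card_image_le[OF assms(1), of J] by simp
  also have "\<dots> < DIM(complex^'n)" using assms by simp
  finally obtain x where x: "x \<noteq> 0" "\<And>y. y \<in> span (S \<union> J ` S) \<Longrightarrow> orthogonal x y"
    using orthogonal_to_subspace_exists by blast
  have "cinner v x = 0" if "v \<in> S" for v
  proof -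
    have "inner v x = 0" "inner (J v) x = 0"
      using x(2)[OF span_base] that by (auto simp: orthogonal_def inner_commute[of _ x])
    moreover have "cinner (J v) x = - \<i> * cinner v x"
      by (simp add: J_def cinner_def sum_distrib_left mult_ac sum_negf)
    ultimately show ?thesis
      by (simp add: inner_eq_Re_cinner complex_eq_iff)
  qed
  with x show ?thesis by blast
qed

text \<open>The eigenvector is a maximiser of the Rayleigh quotient on the orthogonal complement of the
  eigenvectors found so far.\<close>
lemma exists_next_eigenvector:
  fixes A :: "complex^'n^'n"
  assumes A: "hermitian_mat A" and S: "finite S" "card S < CARD('n)"
    and ev: "\<And>v. v \<in> S \<Longrightarrow> \<exists>c::real. A *v v = c *\<^sub>R v"
  shows "\<exists>x c. norm x = 1 \<and> (\<forall>v\<in>S. cinner v x = 0) \<and> A *v x = c *\<^sub>R x"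
proof -
  define W where "W = {x. \<forall>v\<in>S. cinner v x = 0}"
  have contc: "continuous_on UNIV (cinner v)" for v :: "complex^'n"
    unfolding cinner_def by (intro continuous_intros)
  have contA: "continuous_on UNIV ((*v) A)"
    by (intro linear_continuous_on linear_conv_bounded_linear[THEN iffD1] matrix_vector_mul_linear)
  have "closed W"
  proof -
    have "W = (\<Inter>v\<in>S. cinner v -` {0})" by (auto simp: W_def)
    moreover have "closed (cinner v -` {0})" for v :: "complex^'n"
      using continuous_closed_vimage[OF closed_singleton] contc continuous_on_eq_continuous_at
      by (metis open_UNIV iso_tuple_UNIV_I)
    ultimately show ?thesis by auto
  qed
  then have K: "compact (W \<inter> sphere 0 1)"
    by (simp add: closed_Int_compact)
  have scW: "c *\<^sub>R x \<in> W" if "x \<in> W" for c x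
    using that by (simp add: W_def cinner_scaleR_right)
  obtain y where y: "y \<noteq> 0" "y \<in> W"
    using exists_orthogonal_vector[OF S] by (auto simp: W_def)
  have ne: "W \<inter> sphere 0 1 \<noteq> {}"
  proof -
    have "(1 / norm y) *\<^sub>R y \<in> W \<inter> sphere 0 1" using y by (simp add: scW)
    then show ?thesis by blast
  qed
  define q where "q = (\<lambda>x. inner x (A *v x))"
  have "continuous_on (W \<inter> sphere 0 1) q"
    unfolding q_def using contA by (intro continuous_intros)
  from continuous_attains_sup[OF K ne this]
  obtain x where x: "x \<in> W" "norm x = 1" and max: "\<And>z. z \<in> W \<Longrightarrow> norm z = 1 \<Longrightarrow> q z \<le> q x"
    by auto
  have qle: "q z \<le> q x * (norm z)\<^sup>2" if "z \<in> W" for z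
  proof (cases "z = 0")
    case True
    then show ?thesis by (simp add: q_def)
  next
    case False
    have "q ((1 / norm z) *\<^sub>R z) \<le> q x"
      using False that by (intro max scW) auto
    moreover have "q ((1 / norm z) *\<^sub>R z) = q z / (norm z)\<^sup>2"
      unfolding q_def mat_vec_scaleR inner_scaleR_left inner_scaleR_right
      by (simp add: power2_eq_square)
    ultimately show ?thesis using False by (simp add: field_simps)
  qed
  \<comment> \<open>The residual of the eigenvalue equation. It lies in \<open>W\<close>, since a
    Hermitian \<open>A\<close> maps the complement of its eigenvectors into itself, and is therefore
    an admissible direction of variation.\<close>
  define w where "w = A *v x - q x *\<^sub>R x"
  have "A *v x \<in> W"
  proof -
    have "cinner v (A *v x) = 0" if v: "v \<in> S" for v
    proof -
      obtain c where "A *v v = c *\<^sub>R v" using ev v by blast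
      then show ?thesis
        using A x(1) v by (simp add: cinner_mult_vec hermitian_mat_def cinner_scaleR_left W_def)
    qed
    then show ?thesis by (simp add: W_def)
  qed
  then have w: "w \<in> W"
    using scW[OF x(1)] by (simp add: w_def W_def cinner_diff_right)
  have Axw: "A *v x = w + q x *\<^sub>R x" by (simp add: w_def)
  define k where "k = q x * (norm w)\<^sup>2 - q w"
  \<comment> \<open>Comparing \<open>x\<close> with \<open>x + t w\<close>, the terms in
    \<open>inner w x\<close> cancel and \<open>2 t |w|^2 \<le> t^2 k\<close> is left; for small
    \<open>t\<close> this forces \<open>w = 0\<close>.\<close>
  have t: "2 * (norm w)\<^sup>2 \<le> t * k" if "t > 0" for t
  proof -
    have "q (x + t *\<^sub>R w) \<le> q x * (norm (x + t *\<^sub>R w))\<^sup>2"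
      using scW[OF w] x(1) by (intro qle) (simp add: W_def cinner_add_right)
    moreover have "q (x + t *\<^sub>R w) = q x + 2 * t * inner w (A *v x) + t\<^sup>2 * q w"
      using hermitian_inner_commute[OF A, of x w]
      by (simp add: q_def matrix_vector_right_distrib mat_vec_scaleR inner_add_left
        inner_add_right inner_commute power2_eq_square algebra_simps)
    moreover have "(norm (x + t *\<^sub>R w))\<^sup>2 = 1 + 2 * t * inner w x + t\<^sup>2 * (norm w)\<^sup>2"
      using x(2) unfolding power2_norm_eq_inner
      by (simp add: inner_simps inner_commute norm_eq_1 power2_eq_square algebra_simps)
    moreover have "inner w (A *v x) = (norm w)\<^sup>2 + q x * inner w x"
      by (simp add: Axw inner_simps power2_norm_eq_inner)
    ultimately have "2 * t * (norm w)\<^sup>2 \<le> t\<^sup>2 * k"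
      by (simp add: k_def algebra_simps)
    then show ?thesis using that by (simp add: power2_eq_square)
  qed
  have "w = 0"
  proof (rule ccontr)
    assume "w \<noteq> 0"
    then have n: "(norm w)\<^sup>2 > 0" by simp
    have "k > 0" using t[of 1] n by linarith
    then show False using t[of "(norm w)\<^sup>2 / k"] n by (simp add: field_simps)
  qed
  then show ?thesis using Axw x by (auto simp: W_def)
qed

text \<open>The induction runs over the set of indices already served: as long as an index is
  missing, the vectors found number fewer than \<open>CARD('n)\<close>, and a further eigenvector
  orthogonal to them exists.\<close>

lemma hermitian_eigenbasis:
  fixes A :: "complex^'n^'n"
  assumes A: "hermitian_mat A"
  shows "\<exists>h d. (\<forall>k\<in>I. A *v h k = (d k :: real) *\<^sub>R h k) \<and>
    (\<forall>k\<in>I. \<forall>l\<in>I. cinner (h k) (h l) = (if k = (l::'n) then 1 else 0))"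
  using finite[of I]
proof (induction I rule: finite_induct)
  case empty
  then show ?case by simp
next
  case (insert i I)
  then obtain h d where hd: "\<And>k. k \<in> I \<Longrightarrow> A *v h k = (d k :: real) *\<^sub>R h k"
    "\<And>k l. k \<in> I \<Longrightarrow> l \<in> I \<Longrightarrow> cinner (h k) (h l) = (if k = l then 1 else 0)"
    by blast
  have "card (h ` I) < CARD('n)"
    using card_image_le[OF insert(1), of h] insert psubset_card_mono[of UNIV I] by fastforce
  then obtain x c where x: "norm x = 1" "\<And>k. k \<in> I \<Longrightarrow> cinner (h k) x = 0" "A *v x = c *\<^sub>R x"
    using exists_next_eigenvector[OF A, of "h ` I"] hd(1) insert(1) by blast
  have x': "cinner x (h k) = 0" if "k \<in> I" for k
    using x(2)[OF that] by (subst cinner_commute) simp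
  show ?case
    using hd x x' insert(2) unfolding cinner_self[symmetric]
    by (intro exI[of _ "h(i := x)"] exI[of _ "d(i := c)"]) (auto simp: cinner_self[of x])
qed

definition diagonalises :: "complex^'n^'n \<Rightarrow> ('n \<Rightarrow> real) \<Rightarrow> complex^'n^'n \<Rightarrow> bool" where
  "diagonalises U d A \<longleftrightarrow> unitary_mat U \<and> A = U ** diag_mat d ** mat_adjoint U"

theorem hermitian_diagonalisable:
  fixes A :: "complex^'n^'n"
  assumes "hermitian_mat A"
  shows "\<exists>U d. diagonalises U d A"
proof -
  obtain h d where hd: "\<And>k::'n. A *v h k = (d k :: real) *\<^sub>R h k"
    "\<And>k l. cinner (h k) (h l) = (if k = l then 1 else 0)"
    using hermitian_eigenbasis[OF assms, of UNIV] by (metis UNIV_I)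
  define U where "U = (\<chi> i k. h k $ i)"
  have "mat_adjoint U ** U = mat 1"
    using hd(2) by (simp add: vec_eq_iff matrix_matrix_mult_def mat_adjoint_def U_def mat_def
      cinner_def)
  then have u: "unitary_mat U"
    by (simp add: unitary_mat_def matrix_left_right_inverse)
  have "(A ** U) $ i $ k = (U ** diag_mat d) $ i $ k" for i k
    using arg_cong[OF hd(1)[of k], of "\<lambda>v. v $ i"] unfolding diag_mat_mult_right
      vector_scaleR_component
    by (simp add: matrix_vector_mult_def matrix_matrix_mult_def U_def scaleR_conv_of_real
      mult.commute)
  then have "A ** U = U ** diag_mat d" by (simp add: vec_eq_iff)
  then have "A ** (U ** mat_adjoint U) = U ** diag_mat d ** mat_adjoint U"
    by (metis matrix_mul_assoc)
  then show ?thesis using u by (auto simp: diagonalises_def unitary_mat_def)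
qed

section \<open>Double operator integrals\<close>

definition schur :: "(real \<Rightarrow> real \<Rightarrow> real) \<Rightarrow> ('m \<Rightarrow> real) \<Rightarrow> ('n \<Rightarrow> real) \<Rightarrow>
    complex^'n^'m \<Rightarrow> complex^'n^'m"
  where "schur g d e X = (\<chi> k l. complex_of_real (g (d k) (e l)) * X $ k $ l)"

text \<open>If \<open>P\<close> and \<open>Q\<close> link only indices with equal labels, the
  multiplier takes the same value before and after the change of basis. This is why double operator
  integrals do not depend on the diagonalisation.\<close>

lemma schur_intertwine:
  assumes P: "\<And>k k'. d k \<noteq> d' k' \<Longrightarrow> P $ k $ k' = 0"
    and Q: "\<And>l l'. e l \<noteq> e' l' \<Longrightarrow> Q $ l' $ l = 0"
  shows "P ** schur g d' e' X ** Q = schur g d e (P ** X ** Q)"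
proof -
  have "(\<Sum>l'\<in>UNIV. (\<Sum>k'\<in>UNIV. P $ k $ k' * (g (d' k') (e' l') * X $ k' $ l')) * Q $ l' $ l) =
    g (d k) (e l) * (\<Sum>l'\<in>UNIV. (\<Sum>k'\<in>UNIV. P $ k $ k' * X $ k' $ l') * Q $ l' $ l)" for k l
    unfolding sum_distrib_left sum_distrib_right
  proof (intro sum.cong refl)
    fix l' k'
    show "P $ k $ k' * (g (d' k') (e' l') * X $ k' $ l') * Q $ l' $ l =
      g (d k) (e l) * (P $ k $ k' * X $ k' $ l' * Q $ l' $ l)"
      using P[of k k'] Q[of l l'] by (cases "d k = d' k'"; cases "e l = e' l'") auto
  qed
  then show ?thesis
    by (simp add: vec_eq_iff schur_def matrix_matrix_mult_def)
qed

lemma unitary_mult_cancel [simp]: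
  assumes "unitary_mat U"
  shows "mat_adjoint U ** U = mat 1" "U ** mat_adjoint U = mat 1"
    "U ** (mat_adjoint U ** X) = X" "mat_adjoint U ** (U ** X) = X"
    "Y ** U ** mat_adjoint U = Y" "Y ** mat_adjoint U ** U = Y"
  using assms unfolding unitary_mat_def matrix_mul_assoc
  by (simp_all flip: matrix_mul_assoc)

text \<open>Both diagonal forms describe \<open>A\<close>, so the transition matrix intertwines
  them: each of its entries, multiplied by the difference of the two eigenvalues, is zero.\<close>

lemma diagonalises_intertwine:
  assumes "diagonalises U d A" "diagonalises U' d' A" "d k \<noteq> d' k'"
  shows "(mat_adjoint U ** U') $ k $ k' = 0"
proof -
  have u: "unitary_mat U" "unitary_mat U'"
    using assms by (auto simp: diagonalises_def)
  have "U ** diag_mat d ** mat_adjoint U = U' ** diag_mat d' ** mat_adjoint U'"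
    using assms by (simp add: diagonalises_def)
  then have "mat_adjoint U ** (U ** diag_mat d ** mat_adjoint U) ** U' =
      mat_adjoint U ** (U' ** diag_mat d' ** mat_adjoint U') ** U'" by simp
  then have "diag_mat d ** (mat_adjoint U ** U') = mat_adjoint U ** U' ** diag_mat d'"
    using u by (simp add: matrix_mul_assoc)
  then have "d k * (mat_adjoint U ** U') $ k $ k' = (mat_adjoint U ** U') $ k $ k' * d' k'"
    by (metis diag_mat_mult_left diag_mat_mult_right)
  then show ?thesis using assms(3) by (simp add: mult.commute)
qed

text \<open>The list of eigenvalues is chosen first and \<open>eigvec\<close> is then chosen for
  this list, so that the two arbitrary choices fit together.\<close>

definition eigval :: "complex^'n^'n \<Rightarrow> 'n \<Rightarrow> real" where
  "eigval A = (SOME d. \<exists>U. diagonalises U d A)"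

definition eigvec :: "complex^'n^'n \<Rightarrow> complex^'n^'n" where
  "eigvec A = (SOME U. diagonalises U (eigval A) A)"

lemma diagonalises_eig:
  assumes "hermitian_mat A"
  shows "diagonalises (eigvec A) (eigval A) A"
proof -
  have "\<exists>U. diagonalises U (eigval A) A"
    unfolding eigval_def by (rule someI_ex[of "\<lambda>d. \<exists>U. diagonalises U d A"]) (use hermitian_diagonalisable[OF assms] in blast)
  then show ?thesis unfolding eigvec_def by (rule someI_ex)
qed

text \<open>The double operator integral with symbol \<open>g\<close>: in spectral projections
  \<open>A = \<Sum> a P\<^sub>a\<close> and \<open>B = \<Sum> b Q\<^sub>b\<close> it is \<open>\<Sum> g a b P\<^sub>a H Q\<^sub>b\<close>.\<close>
definition dop :: "(real \<Rightarrow> real \<Rightarrow> real) \<Rightarrow> complex^'m^'m \<Rightarrow> complex^'n^'n \<Rightarrow>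
    complex^'n^'m \<Rightarrow> complex^'n^'m"
  where "dop g A B H = eigvec A **
    schur g (eigval A) (eigval B) (mat_adjoint (eigvec A) ** H ** eigvec B) **
    mat_adjoint (eigvec B)"

text \<open>The transition matrices between two eigenbases satisfy the conditions of
  \<open>schur_intertwine\<close>, so they pass through the Schur multiplier and cancel.\<close>

lemma dop_eq:
  assumes "hermitian_mat A" "hermitian_mat B" "diagonalises U d A" "diagonalises V e B"
  shows "dop g A B H = U ** schur g d e (mat_adjoint U ** H ** V) ** mat_adjoint V"
proof -
  let ?U = "eigvec A" and ?d = "eigval A" and ?V = "eigvec B" and ?e = "eigval B"
  have dg: "diagonalises ?U ?d A" "diagonalises ?V ?e B"
    using assms by (auto intro: diagonalises_eig)
  have u: "unitary_mat U" "unitary_mat V" "unitary_mat ?U" "unitary_mat ?V"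
    using assms dg by (auto simp: diagonalises_def)
  have "dop g A B H = U ** ((mat_adjoint U ** ?U) **
      schur g ?d ?e (mat_adjoint ?U ** H ** ?V) ** (mat_adjoint ?V ** V)) ** mat_adjoint V"
    using u unfolding dop_def by (simp add: matrix_mul_assoc)
  also have "(mat_adjoint U ** ?U) ** schur g ?d ?e (mat_adjoint ?U ** H ** ?V) **
      (mat_adjoint ?V ** V) =
    schur g d e ((mat_adjoint U ** ?U) ** (mat_adjoint ?U ** H ** ?V) ** (mat_adjoint ?V ** V))"
    by (rule schur_intertwine) (use diagonalises_intertwine assms dg in metis)+
  also have "(mat_adjoint U ** ?U) ** (mat_adjoint ?U ** H ** ?V) ** (mat_adjoint ?V ** V) =
      mat_adjoint U ** H ** V"
    using u by (simp add: matrix_mul_assoc)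
  finally show ?thesis .
qed

lemma matrix_scaleR_left: "(c *\<^sub>R A) ** (B :: complex^'n^'m) = c *\<^sub>R (A ** B)"
  unfolding vec_eq_iff matrix_matrix_mult_def vector_scaleR_component
  by (simp add: scaleR_sum_right vector_scaleR_component)

lemma matrix_scaleR_right: "(A :: complex^'k^'m) ** (c *\<^sub>R B) = c *\<^sub>R (A ** B)"
  unfolding vec_eq_iff matrix_matrix_mult_def vector_scaleR_component
  by (simp add: scaleR_sum_right vector_scaleR_component)

lemma matrix_add_rdistrib: "((A :: complex^'k^'m) + B) ** C = A ** C + B ** C"
  by (simp add: vec_eq_iff matrix_matrix_mult_def ring_distribs sum.distrib)

lemma schur_add_left:
  "schur (\<lambda>x y. g x y + h x y) d e X = schur g d e X + schur h d e X"
  by (simp add: schur_def vec_eq_iff ring_distribs)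

lemma schur_scaleR_left: "schur (\<lambda>x y. c * g x y) d e X = c *\<^sub>R schur g d e X"
  unfolding vec_eq_iff schur_def vector_scaleR_component
  by (simp add: vector_scaleR_component scaleR_conv_of_real)

lemma schur_schur: "schur g d e (schur h d e X) = schur (\<lambda>x y. g x y * h x y) d e X"
  by (simp add: schur_def vec_eq_iff)

lemma schur_one: "schur (\<lambda>x y. 1) d e X = X"
  by (simp add: schur_def vec_eq_iff)

lemma schur_scaleR_right: "schur g d e (c *\<^sub>R X) = c *\<^sub>R schur g d e X"
  unfolding vec_eq_iff schur_def vector_scaleR_component
  by (simp add: vector_scaleR_component)

lemma unitary_eigvec: "hermitian_mat A \<Longrightarrow> unitary_mat (eigvec A)"
  using diagonalises_eig diagonalises_def by blast

lemma dop_scaleR_right: "dop g A B (c *\<^sub>R X) = c *\<^sub>R dop g A B X"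
  by (simp add: dop_def schur_scaleR_right matrix_scaleR_left matrix_scaleR_right)

lemma dop_add: "dop (\<lambda>x y. g x y + h x y) A B H = dop g A B H + dop h A B H"
  by (simp add: dop_def schur_add_left matrix_add_ldistrib matrix_add_rdistrib)

lemma dop_scaleR: "dop (\<lambda>x y. c * g x y) A B H = c *\<^sub>R dop g A B H"
  by (simp add: dop_def schur_scaleR_left matrix_scaleR_left matrix_scaleR_right)

lemma dop_diff: "dop (\<lambda>x y. g x y - h x y) A B H = dop g A B H - dop h A B H"
  using dop_add[of g "\<lambda>x y. (-1) * h x y" A B H] unfolding dop_scaleR by simp

lemma dop_mult:
  assumes "hermitian_mat A" "hermitian_mat B"
  shows "dop g A B (dop h A B H) = dop (\<lambda>x y. g x y * h x y) A B H"
  using assms by (simp add: unitary_eigvec dop_def matrix_mul_assoc schur_schur)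

lemma dop_cong:
  assumes "\<And>k l. g (eigval A k) (eigval B l) = h (eigval A k) (eigval B l)"
  shows "dop g A B H = dop h A B H"
  using assms by (simp add: dop_def schur_def)

lemma dop_one:
  assumes "hermitian_mat A" "hermitian_mat B"
  shows "dop (\<lambda>x y. 1) A B H = H"
  using assms by (simp add: unitary_eigvec dop_def matrix_mul_assoc schur_one)

section \<open>Functional calculus as a special case of double operator integrals\<close>

definition mat_fun :: "(real \<Rightarrow> real) \<Rightarrow> complex^'n^'n \<Rightarrow> complex^'n^'n" where
  "mat_fun f A = eigvec A ** diag_mat (\<lambda>k. f (eigval A k)) ** mat_adjoint (eigvec A)"

lemma schur_left: "schur (\<lambda>x y. f x) d e X = diag_mat (\<lambda>k. f (d k)) ** X"
  by (simp add: vec_eq_iff diag_mat_mult_left schur_def)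

lemma schur_right: "schur (\<lambda>x y. f y) d e X = X ** diag_mat (\<lambda>k. f (e k))"
  by (simp add: vec_eq_iff diag_mat_mult_right schur_def mult.commute)

text \<open>Together with \<open>dop_mult\<close> this turns products of functions of
  \<open>A\<close> and \<open>B\<close> around a middle matrix into pointwise products of symbols;
  all later matrix computations are done on symbols.\<close>

lemma dop_left:
  assumes "hermitian_mat A" "hermitian_mat B"
  shows "dop (\<lambda>x y. f x) A B H = mat_fun f A ** H"
  using assms by (simp add: unitary_eigvec dop_def mat_fun_def schur_left matrix_mul_assoc)

lemma dop_right:
  assumes "hermitian_mat A" "hermitian_mat B"
  shows "dop (\<lambda>x y. f y) A B H = H ** mat_fun f B"
  using assms by (simp add: unitary_eigvec dop_def mat_fun_def schur_right matrix_mul_assoc)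

lemma mat_fun_eq:
  assumes "hermitian_mat A" "diagonalises U d A"
  shows "mat_fun f A = U ** diag_mat (\<lambda>k. f (d k)) ** mat_adjoint U"
proof -
  have "unitary_mat U" using assms by (simp add: diagonalises_def)
  moreover have "mat_fun f A = dop (\<lambda>x y. f x) A A (mat 1)"
    using assms by (simp add: dop_left)
  ultimately show ?thesis
    using dop_eq[OF assms(1,1,2,2), of "\<lambda>x y. f x" "mat 1"] by (simp add: schur_left)
qed

text \<open>Resolves the definite description: the chosen diagonalisation gives existence, and
  \<open>mat_fun_eq\<close> gives uniqueness, since every diagonalisation leads to the same
  matrix.\<close>

lemma mat_powr_eq_mat_fun:
  assumes "hermitian_mat A"
  shows "mat_powr A p = mat_fun (\<lambda>x. x powr p) A"
  unfolding mat_powr_def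
proof (rule the_equality)
  show "\<exists>U d. unitary_mat U \<and> A = U ** diag_mat d ** mat_adjoint U \<and>
      mat_fun (\<lambda>x. x powr p) A = U ** diag_mat (\<lambda>k. d k powr p) ** mat_adjoint U"
    using diagonalises_eig[OF assms] unfolding diagonalises_def mat_fun_def by blast
next
  fix B
  assume "\<exists>U d. unitary_mat U \<and> A = U ** diag_mat d ** mat_adjoint U \<and>
      B = U ** diag_mat (\<lambda>k. d k powr p) ** mat_adjoint U"
  then obtain U d where "diagonalises U d A"
    and B: "B = U ** diag_mat (\<lambda>k. d k powr p) ** mat_adjoint U"
    unfolding diagonalises_def by blast
  from mat_fun_eq[OF assms this(1)] show "B = mat_fun (\<lambda>x. x powr p) A"
    unfolding B by (rule sym)
qed

lemma mat_fun_id: "hermitian_mat A \<Longrightarrow> mat_fun (\<lambda>x. x) A = A"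
  using diagonalises_eig[of A] unfolding mat_fun_def diagonalises_def by (blast intro: sym)

lemma mat_fun_const_one: "hermitian_mat A \<Longrightarrow> mat_fun (\<lambda>x. 1) A = mat 1"
  using dop_one[of A A "mat 1"] dop_left[of A A "\<lambda>x. 1" "mat 1"] by simp

lemma hermitian_mat_fun: "hermitian_mat (mat_fun f A)"
  by (simp add: hermitian_mat_def mat_fun_def mat_adjoint_mult matrix_mul_assoc)

lemma mat_fun_mult:
  assumes "hermitian_mat A"
  shows "mat_fun f A ** mat_fun g A = mat_fun (\<lambda>x. f x * g x) A"
  using dop_mult[OF assms assms, of "\<lambda>x y. f x" "\<lambda>x y. g x" "mat 1"]
  by (simp add: dop_left[OF assms assms])

lemma mat_fun_cong:
  assumes "\<And>k. f (eigval A k) = g (eigval A k)"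
  shows "mat_fun f A = mat_fun g A"
  using assms by (simp add: mat_fun_def)

lemma diagonalises_mat_fun:
  "hermitian_mat A \<Longrightarrow> diagonalises (eigvec A) (\<lambda>k. f (eigval A k)) (mat_fun f A)"
  by (simp add: diagonalises_def mat_fun_def unitary_eigvec)

text \<open>Functions of \<open>A\<close> and \<open>B\<close> keep their eigenvectors, so only the
  symbol is reparametrised. Eigenvalues that \<open>u\<close> or \<open>v\<close> identifies do no
  harm, because \<open>dop_eq\<close> admits any diagonalisation.\<close>

lemma dop_mat_fun:
  assumes "hermitian_mat A" "hermitian_mat B"
  shows "dop g (mat_fun u A) (mat_fun v B) H = dop (\<lambda>x y. g (u x) (v y)) A B H"
  unfolding dop_eq[OF hermitian_mat_fun hermitian_mat_fun diagonalises_mat_fun[OF assms(1)]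
      diagonalises_mat_fun[OF assms(2)]]
  by (simp add: dop_def schur_def)

lemma mat_fun_mat_fun:
  assumes "hermitian_mat A"
  shows "mat_fun f (mat_fun g A) = mat_fun (\<lambda>x. f (g x)) A"
  unfolding mat_fun_eq[OF hermitian_mat_fun diagonalises_mat_fun[OF assms]]
  by (simp add: mat_fun_def)

definition divdiff :: "(real \<Rightarrow> real) \<Rightarrow> (real \<Rightarrow> real) \<Rightarrow> real \<Rightarrow> real \<Rightarrow> real" where
  "divdiff f f' x y = (if x = y then f' x else (f x - f y) / (x - y))"

text \<open>The difference \<open>A - B\<close> is itself the double operator integral of the symbol
  \<open>x - y\<close> at the identity, and \<open>x - y\<close> times the divided difference is
  \<open>f x - f y\<close>. The formula is exact, and \<open>A\<close> and \<open>B\<close> need not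
  commute.\<close>

lemma mat_fun_diff:
  assumes "hermitian_mat A" "hermitian_mat B"
  shows "mat_fun f A - mat_fun f B = dop (divdiff f f') A B (A - B)"
proof -
  have eq: "dop (\<lambda>x y. h x - h y) A B (mat 1) = mat_fun h A - mat_fun h B" for h
    by (simp add: dop_diff dop_left[OF assms] dop_right[OF assms])
  have "dop (divdiff f f') A B (A - B) = dop (divdiff f f') A B (dop (\<lambda>x y. x - y) A B (mat 1))"
    using eq[of "\<lambda>x. x"] by (simp add: mat_fun_id assms)
  also have "\<dots> = dop (\<lambda>x y. divdiff f f' x y * (x - y)) A B (mat 1)"
    by (rule dop_mult[OF assms])
  also have "(\<lambda>x y. divdiff f f' x y * (x - y)) = (\<lambda>x y. f x - f y)"
    by (auto simp: divdiff_def fun_eq_iff)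
  finally show ?thesis by (simp add: eq)
qed

section \<open>Traces of double operator integrals\<close>

lemma trace_unitary:
  assumes "unitary_mat U"
  shows "trace (U ** X ** mat_adjoint U) = trace X"
  using assms by (simp add: trace_mul_sym[of _ "mat_adjoint U"])

lemma trace_mult_eq_sum: "trace (A ** B) = (\<Sum>k\<in>UNIV. \<Sum>l\<in>UNIV. A $ k $ l * B $ l $ k)"
  by (simp add: trace_def matrix_matrix_mult_def)

text \<open>In an eigenbasis of \<open>A\<close> the trace sees only the diagonal of the Schur
  multiplier, where the symbol is \<open>g x x\<close>. For a divided difference this is the
  ordinary derivative.\<close>

lemma trace_mat_fun_dop:
  assumes A: "hermitian_mat A"
  shows "trace (mat_fun k A ** dop g A A H) = trace (mat_fun (\<lambda>x. k x * g x x) A ** H)"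
proof -
  let ?U = "eigvec A"
  note u = unitary_eigvec[OF A]
  have r: "trace (dop h A A H) = (\<Sum>i\<in>UNIV. h (eigval A i) (eigval A i) * (mat_adjoint ?U ** H ** ?U) $ i $ i)" for h
    unfolding dop_def by (subst trace_unitary[OF u]) (simp add: trace_def schur_def)
  show ?thesis
    unfolding dop_left[OF A A, symmetric] dop_mult[OF A A] r by simp
qed

lemma trace_dop_mult:
  assumes A: "hermitian_mat A"
  shows "trace (dop g A A X ** Y) = (\<Sum>k\<in>UNIV. \<Sum>l\<in>UNIV. g (eigval A k) (eigval A l) *
    ((mat_adjoint (eigvec A) ** X ** eigvec A) $ k $ l * (mat_adjoint (eigvec A) ** Y ** eigvec A) $ l $ k))"
proof -
  let ?U = "eigvec A"
  note u = unitary_eigvec[OF A]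
  have "dop g A A X ** Y = ?U ** (schur g (eigval A) (eigval A) (mat_adjoint ?U ** X ** ?U) **
      (mat_adjoint ?U ** Y ** ?U)) ** mat_adjoint ?U"
    using u by (simp add: dop_def matrix_mul_assoc)
  then show ?thesis
    by (simp only: trace_unitary[OF u]) (simp add: trace_mult_eq_sum, simp add: schur_def mult.assoc)
qed

text \<open>The trace pairs entry \<open>(k, l)\<close> of one factor with entry
  \<open>(l, k)\<close> of the other, so a symmetric multiplier can be moved from the second factor
  to the first.\<close>

lemma trace_dop_mult_dop:
  assumes A: "hermitian_mat A" and h: "\<And>x y. h x y = h y x"
  shows "trace (dop g A A X ** dop h A A Y) = trace (dop (\<lambda>x y. g x y * h x y) A A X ** Y)"
proof -
  have "(mat_adjoint (eigvec A) ** dop h A A Y ** eigvec A) $ l $ k =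
      h (eigval A k) (eigval A l) * (mat_adjoint (eigvec A) ** Y ** eigvec A) $ l $ k" for k l
    using unitary_eigvec[OF A] h by (simp add: dop_def matrix_mul_assoc schur_def)
  then show ?thesis
    by (simp add: trace_dop_mult[OF A] mult_ac)
qed

section \<open>Derivatives of matrix powers\<close>

lemma norm_matrix_sq: "(norm (X :: complex^'n^'m))\<^sup>2 = (\<Sum>i\<in>UNIV. \<Sum>j\<in>UNIV. (cmod (X $ i $ j))\<^sup>2)"
  by (simp add: power2_norm_eq_inner inner_vec_def)

lemma norm_mat_adjoint [simp]: "norm (mat_adjoint X) = norm X"
proof -
  have "(norm (mat_adjoint X))\<^sup>2 = (norm X)\<^sup>2"
    unfolding norm_matrix_sq mat_adjoint_def by (simp, rule sum.swap)
  then show ?thesis by simp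
qed

lemma norm_matrix_sq_trace: "complex_of_real ((norm X)\<^sup>2) = trace (mat_adjoint X ** X)"
  unfolding norm_matrix_sq trace_mult_eq_sum
  by (subst sum.swap) (simp add: mat_adjoint_def complex_norm_square mult.commute del: of_real_power)

lemma norm_unitary_left:
  assumes "unitary_mat U"
  shows "norm (U ** X) = norm X"
proof -
  have "complex_of_real ((norm (U ** X))\<^sup>2) = complex_of_real ((norm X)\<^sup>2)"
    unfolding norm_matrix_sq_trace mat_adjoint_mult using assms
    by (simp flip: matrix_mul_assoc)
  then have "(norm (U ** X))\<^sup>2 = (norm X)\<^sup>2" by (simp only: of_real_eq_iff)
  then show ?thesis by simp
qed

lemma unitary_mat_adjoint: "unitary_mat U \<Longrightarrow> unitary_mat (mat_adjoint U)"
  by (simp add: unitary_mat_def del: unitary_mult_cancel)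

lemma norm_unitary_right:
  assumes "unitary_mat U"
  shows "norm (X ** U) = norm X"
  using norm_unitary_left[OF unitary_mat_adjoint[OF assms], of "mat_adjoint X"]
  by (simp flip: mat_adjoint_mult)

text \<open>The norm of this type is the Frobenius norm, which is entrywise, so a bound on the
  symbol at the eigenvalues suffices. In the operator norm a supremum bound with the same constant
  would fail.\<close>

lemma norm_schur_le:
  assumes "\<And>k l. \<bar>g (d k) (e l)\<bar> \<le> c" "0 \<le> c"
  shows "norm (schur g d e X) \<le> c * norm X"
proof (rule power2_le_imp_le)
  have "(norm (schur g d e X))\<^sup>2 \<le> (\<Sum>i\<in>UNIV. \<Sum>j\<in>UNIV. c\<^sup>2 * (cmod (X $ i $ j))\<^sup>2)"
    unfolding norm_matrix_sq schur_def
    using assms by (intro sum_mono) (auto simp: norm_mult power_mult_distrib intro!: mult_right_mono abs_le_square_iff[THEN iffD1])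
  also have "\<dots> = (c * norm X)\<^sup>2"
    by (simp add: norm_matrix_sq power_mult_distrib sum_distrib_left)
  finally show "(norm (schur g d e X))\<^sup>2 \<le> (c * norm X)\<^sup>2" .
qed (use assms in simp)

lemma norm_dop_le:
  assumes "hermitian_mat A" "hermitian_mat B"
    "\<And>k l. \<bar>g (eigval A k) (eigval B l)\<bar> \<le> c" "0 \<le> c"
  shows "norm (dop g A B H) \<le> c * norm H"
proof -
  have "norm (dop g A B H) = norm (schur g (eigval A) (eigval B) (mat_adjoint (eigvec A) ** H ** eigvec B))"
    using assms by (simp add: dop_def norm_unitary_left norm_unitary_right unitary_eigvec unitary_mat_adjoint)
  also have "\<dots> \<le> c * norm (mat_adjoint (eigvec A) ** H ** eigvec B)"
    by (rule norm_schur_le) (use assms in auto)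
  also have "norm (mat_adjoint (eigvec A) ** H ** eigvec B) = norm H"
    using assms by (simp add: norm_unitary_left norm_unitary_right unitary_eigvec unitary_mat_adjoint)
  finally show ?thesis .
qed

section \<open>Joint continuity of double operator integrals\<close>

lemma tendsto_matrix_mult [tendsto_intros]:
  fixes A :: "'a \<Rightarrow> complex^'k^'m" and B :: "'a \<Rightarrow> complex^'n^'k"
  assumes "(A \<longlongrightarrow> a) F" "(B \<longlongrightarrow> b) F"
  shows "((\<lambda>t. A t ** B t) \<longlongrightarrow> a ** b) F"
  unfolding matrix_matrix_mult_def
  by (intro tendsto_vec_lambda tendsto_sum tendsto_mult tendsto_vec_nth assms)

lemma tendsto_dop_polynomial:
  fixes p :: "real \<times> real \<Rightarrow> real"
    and A :: "'a \<Rightarrow> complex^'m^'m" and B :: "'a \<Rightarrow> complex^'n^'n"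
  assumes "real_polynomial_function p"
    and herm: "\<And>t. hermitian_mat (A t)" "hermitian_mat A0" "\<And>t. hermitian_mat (B t)" "hermitian_mat B0"
    and lim: "(A \<longlongrightarrow> A0) F" "(B \<longlongrightarrow> B0) F"
    and "(H \<longlongrightarrow> H0) F"
  shows "((\<lambda>t. dop (\<lambda>x y. p (x, y)) (A t) (B t) (H t)) \<longlongrightarrow> dop (\<lambda>x y. p (x, y)) A0 B0 H0) F"
  using assms(1) assms(8)
\<comment> \<open>The middle matrix has to be general: for a product of symbols, one double operator
  integral is applied to the result of the other.\<close>
proof (induction p arbitrary: H H0)
  case (linear f)
  interpret f: bounded_linear f by fact
  have eq: "(\<lambda>x y. f (x, y)) = (\<lambda>x y. f (1, 0) * x + f (0, 1) * y)"
  proof (intro ext)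
    fix x y :: real
    have "f (x, y) = f (x *\<^sub>R (1, 0) + y *\<^sub>R (0, 1))" by simp
    also have "\<dots> = f (1, 0) * x + f (0, 1) * y" by (simp only: f.add f.scaleR) simp
    finally show "f (x, y) = f (1, 0) * x + f (0, 1) * y" .
  qed
  \<comment> \<open>The first coordinate acts as left multiplication by \<open>C\<close> and the
    second as right multiplication by \<open>D\<close>, so no eigenvector is left in the
    expression.\<close>
  have "dop (\<lambda>x y. f (x, y)) C D K = f (1, 0) *\<^sub>R (C ** K) + f (0, 1) *\<^sub>R (K ** D)"
    if "hermitian_mat C" "hermitian_mat D" for C :: "complex^'m^'m" and D :: "complex^'n^'n" and K
    using that unfolding eq dop_add dop_scaleR
    by (simp add: dop_left[where f = "\<lambda>x. x"] dop_right[where f = "\<lambda>x. x"] mat_fun_id)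
  then show ?case
    by (simp add: herm) (intro tendsto_intros lim linear.prems)
next
  case (const c)
  have "dop (\<lambda>x y. c) C D K = c *\<^sub>R K" if "hermitian_mat C" "hermitian_mat D"
    for C :: "complex^'m^'m" and D :: "complex^'n^'n" and K
    using dop_scaleR[of c "\<lambda>x y. 1" C D K] that by (simp add: dop_one)
  then show ?case
    by (simp add: herm) (intro tendsto_intros const)
next
  case (add f g)
  then show ?case unfolding dop_add by (intro tendsto_add)
next
  case (mult f g)
  have "((\<lambda>t. dop (\<lambda>x y. f (x, y)) (A t) (B t) (dop (\<lambda>x y. g (x, y)) (A t) (B t) (H t))) \<longlongrightarrow>
      dop (\<lambda>x y. f (x, y)) A0 B0 (dop (\<lambda>x y. g (x, y)) A0 B0 H0)) F"
    by (intro mult)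
  then show ?case by (simp add: dop_mult herm)
qed

text \<open>Polynomial symbols give products of \<open>A\<close>, \<open>H\<close> and \<open>B\<close>; the general symbol is a uniform limit.\<close>
lemma tendsto_dop:
  fixes A :: "'a \<Rightarrow> complex^'m^'m" and B :: "'a \<Rightarrow> complex^'n^'n"
  assumes g: "continuous_on ({m..M} \<times> {m..M}) (\<lambda>(x, y). g x y)"
    and herm: "\<And>t. hermitian_mat (A t)" "hermitian_mat A0" "\<And>t. hermitian_mat (B t)" "hermitian_mat B0"
    and lim: "(A \<longlongrightarrow> A0) F" "(B \<longlongrightarrow> B0) F" and H: "(H \<longlongrightarrow> H0) F"
    and ev: "\<forall>\<^sub>F t in F. \<forall>k. eigval (A t) k \<in> {m..M}" "\<forall>\<^sub>F t in F. \<forall>k. eigval (B t) k \<in> {m..M}"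
    and ev0: "\<And>k. eigval A0 k \<in> {m..M}" "\<And>k. eigval B0 k \<in> {m..M}"
  shows "((\<lambda>t. dop g (A t) (B t) (H t)) \<longlongrightarrow> dop g A0 B0 H0) F"
proof (rule tendstoI)
  fix e :: real
  assume "0 < e"
  \<comment> \<open>The constant splits the error into thirds. The summand 1 leaves room for
    \<open>H t\<close>, whose norm is eventually below \<open>norm H0 + 1\<close>, and keeps the
    denominator positive.\<close>
  define d where "d = e / (3 * (norm H0 + 1))"
  have n: "norm H0 + 1 > 0" by (smt (verit) norm_ge_zero)
  then have d: "d > 0" using \<open>0 < e\<close> by (simp add: d_def)
  obtain p where p: "real_polynomial_function p"
    "\<And>z. z \<in> {m..M} \<times> {m..M} \<Longrightarrow> \<bar>(case z of (x, y) \<Rightarrow> g x y) - p z\<bar> < d"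
    using Stone_Weierstrass_real_polynomial_function[OF _ g d] by (auto intro: compact_Times)
  define q where "q = (\<lambda>x y. p (x, y))"
  have approx: "norm (dop g C D K - dop q C D K) < e / 3"
    if "hermitian_mat C" "hermitian_mat D" "\<forall>k. eigval C k \<in> {m..M}" "\<forall>k. eigval D k \<in> {m..M}"
      "norm K < norm H0 + 1"
    for C :: "complex^'m^'m" and D :: "complex^'n^'n" and K
  proof -
    have "norm (dop (\<lambda>x y. g x y - q x y) C D K) \<le> d * norm K"
    proof (rule norm_dop_le[OF that(1,2)])
      show "\<bar>g (eigval C k) (eigval D l) - q (eigval C k) (eigval D l)\<bar> \<le> d" for k l
        using p(2)[of "(eigval C k, eigval D l)"] that(3,4) by (simp add: q_def)
    qed (use d in simp)
    also have "\<dots> < d * (norm H0 + 1)" using d that by simp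
    also have "\<dots> = e / 3" using n unfolding d_def by (simp add: divide_simps)
    finally show ?thesis by (simp add: dop_diff)
  qed
  have "\<forall>\<^sub>F t in F. dist (dop q (A t) (B t) (H t)) (dop q A0 B0 H0) < e / 3"
    using tendstoD[OF tendsto_dop_polynomial[OF p(1) herm lim H], of "e / 3"] \<open>0 < e\<close>
    by (simp add: q_def)
  moreover have "\<forall>\<^sub>F t in F. norm (H t) < norm H0 + 1"
    using order_tendstoD(2)[OF tendsto_norm[OF H]] by simp
  ultimately show "\<forall>\<^sub>F t in F. dist (dop g (A t) (B t) (H t)) (dop g A0 B0 H0) < e"
    using ev
  proof eventually_elim
    case (elim t)
    have "norm (dop g (A t) (B t) (H t) - dop q (A t) (B t) (H t)) < e / 3"
      using elim herm by (intro approx) auto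
    moreover have "norm (dop g A0 B0 H0 - dop q A0 B0 H0) < e / 3"
      using ev0 herm by (intro approx) auto
    ultimately show ?case
      using elim(1) unfolding dist_norm by norm
  qed
qed

section \<open>Spectral bounds near a positive definite matrix\<close>

lemma norm_matrix_vector_mult_le: "norm ((A :: complex^'n^'m) *v x) \<le> norm A * norm x"
proof (rule power2_le_imp_le)
  have 1: "cmod ((A *v x) $ i) \<le> norm (A $ i) * norm x" for i
  proof -
    have "cmod ((A *v x) $ i) \<le> (\<Sum>j\<in>UNIV. cmod (A $ i $ j) * cmod (x $ j))"
      unfolding matrix_vector_mult_def by (auto intro!: sum_norm_le simp: norm_mult)
    also have "\<dots> \<le> norm (A $ i) * norm x"
      unfolding norm_vec_def using L2_set_mult_ineq[of "\<lambda>j. cmod (A $ i $ j)" "\<lambda>j. cmod (x $ j)" UNIV]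
      by simp
    finally show ?thesis .
  qed
  have "(norm (A *v x))\<^sup>2 = (\<Sum>i\<in>UNIV. (cmod ((A *v x) $ i))\<^sup>2)"
    by (simp add: power2_norm_eq_inner inner_vec_def)
  also have "\<dots> \<le> (\<Sum>i\<in>UNIV. (norm (A $ i))\<^sup>2 * (norm x)\<^sup>2)"
    by (intro sum_mono) (metis 1 norm_ge_zero power_mono power_mult_distrib)
  also have "\<dots> = (norm A * norm x)\<^sup>2"
    by (simp add: power_mult_distrib power2_norm_eq_inner inner_vec_def sum_distrib_right)
  finally show "(norm (A *v x))\<^sup>2 \<le> (norm A * norm x)\<^sup>2" .
qed simp

text \<open>The vector is column \<open>k\<close> of \<open>eigvec A\<close>. Written as values of
  the quadratic form, eigenvalues inherit bounds of the form on the unit sphere.\<close>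

lemma eigval_eq_inner:
  assumes A: "hermitian_mat A"
  obtains u where "norm u = 1" "eigval A k = inner u (A *v u)"
proof
  let ?U = "eigvec A" and ?u = "column k (eigvec A)"
  have 1: "cinner ?u (B *v ?u) = (mat_adjoint ?U ** B ** ?U) $ k $ k" for B
  proof -
    have "B *v ?u = column k (B ** ?U)"
      by (simp add: vec_eq_iff column_def matrix_vector_mult_def matrix_matrix_mult_def)
    then show ?thesis
      by (simp add: cinner_def column_def mat_adjoint_def matrix_matrix_mult_def[of _ "_ ** _"]
        flip: matrix_mul_assoc)
  qed
  have "mat_adjoint ?U ** A ** ?U = mat_adjoint ?U ** (mat_fun (\<lambda>x. x) A) ** ?U"
    by (simp add: mat_fun_id A)
  also have "\<dots> = diag_mat (eigval A)"
    by (simp add: mat_fun_def unitary_eigvec A matrix_mul_assoc)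
  finally show "eigval A k = inner ?u (A *v ?u)"
    using 1[of A] by (simp add: inner_eq_Re_cinner diag_mat_def)
  have "cinner ?u ?u = 1"
    using 1[of "mat 1"] by (simp add: unitary_eigvec A) (simp add: mat_def)
  then show "norm ?u = 1"
    using abs_square_eq_1[of "norm ?u"] unfolding cinner_self by (simp only: of_real_eq_1_iff) simp
qed

lemma pos_def_hermitian: "pos_def A \<Longrightarrow> hermitian_mat A"
  by (simp add: pos_def_def)

lemma eigval_pos:
  assumes "pos_def A"
  shows "eigval A k > 0"
proof -
  obtain u where u: "norm u = 1" "eigval A k = inner u (A *v u)"
    by (rule eigval_eq_inner[OF pos_def_hermitian[OF assms]])
  then have "u \<noteq> 0" by auto
  then show ?thesis using assms u(2) by (simp add: pos_def_def inner_eq_Re_cinner)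
qed

text \<open>On the compact unit sphere the form of \<open>A0\<close> has a positive minimum, and a
  perturbation of at most half that size moves each of its values by at most that half. The
  resulting compact interval of positive reals serves all nearby matrices at once, as the uniform
  approximation of the symbol requires.\<close>

lemma eigval_eventually_bounded:
  fixes A0 :: "complex^'n^'n"
  assumes A0: "pos_def A0"
  obtains m M where "0 < m" "\<And>k. eigval A0 k \<in> {m..M}"
    "\<And>A F. (A \<longlongrightarrow> A0) F \<Longrightarrow> (\<And>t. hermitian_mat (A t)) \<Longrightarrow> \<forall>\<^sub>F t in F. \<forall>k. eigval (A t) k \<in> {m..M}"
proof -
  define q where "q = (\<lambda>u. inner u (A0 *v u))"
  have S: "compact (sphere (0 :: complex^'n) 1)" "sphere (0 :: complex^'n) 1 \<noteq> {}"
    by auto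
  have "continuous_on UNIV ((*v) A0)"
    by (intro linear_continuous_on linear_conv_bounded_linear[THEN iffD1] matrix_vector_mul_linear)
  then have q: "continuous_on (sphere 0 1) q"
    unfolding q_def by (intro continuous_intros)
  obtain v where v: "norm v = 1" "\<And>u. norm u = 1 \<Longrightarrow> q v \<le> q u"
    using continuous_attains_inf[OF S q] by auto
  obtain w where w: "norm w = 1" "\<And>u. norm u = 1 \<Longrightarrow> q u \<le> q w"
    using continuous_attains_sup[OF S q] by auto
  have "v \<noteq> 0" using v(1) by auto
  then have pos: "q v > 0"
    using A0 by (simp add: pos_def_def q_def inner_eq_Re_cinner)
  define m M where "m = q v / 2" and "M = q w + q v / 2"
  have near: "eigval A k \<in> {m..M}" if A: "hermitian_mat A" and le: "norm (A - A0) \<le> q v / 2" for A k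
  proof -
    obtain u where u: "norm u = 1" "eigval A k = inner u (A *v u)"
      by (rule eigval_eq_inner[OF A])
    have "A *v u = A0 *v u + (A - A0) *v u"
      by (simp add: matrix_vector_mult_diff_rdistrib)
    then have "eigval A k = q u + inner u ((A - A0) *v u)"
      by (simp add: u q_def inner_add_right)
    moreover have "\<bar>inner u ((A - A0) *v u)\<bar> \<le> q v / 2"
      using Cauchy_Schwarz_ineq2[of u "(A - A0) *v u"] norm_matrix_vector_mult_le[of "A - A0" u]
        le u(1) by simp
    ultimately show ?thesis
      using v(2)[OF u(1)] w(2)[OF u(1)] by (auto simp: m_def M_def)
  qed
  show ?thesis
  proof
    show "0 < m" using pos by (simp add: m_def)
    show "eigval A0 k \<in> {m..M}" for k
      using near[OF pos_def_hermitian[OF A0]] pos by simp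
    show "\<forall>\<^sub>F t in F. \<forall>k. eigval (A t) k \<in> {m..M}"
      if "(A \<longlongrightarrow> A0) F" "\<And>t. hermitian_mat (A t)" for A and F :: "'b filter"
    proof -
      have "\<forall>\<^sub>F t in F. dist (A t) A0 < q v / 2"
        using pos by (intro tendstoD[OF that(1)]) simp
      then show ?thesis
        by eventually_elim (use near that(2) in \<open>auto simp: dist_norm less_imp_le\<close>)
    qed
  qed
qed

section \<open>Continuity of divided differences\<close>

lemma divdiff_mean_value:
  assumes f: "\<And>x. x > 0 \<Longrightarrow> (f has_real_derivative f' x) (at x)" and "0 < x" "0 < y"
  obtains z where "min x y \<le> z" "z \<le> max x y" "divdiff f f' x y = f' z"
proof (cases x y rule: linorder_cases)
  case less
  then obtain z where "x < z" "z < y" "f y - f x = (y - x) * f' z"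
    using MVT2[of x y f f'] f assms(2) by (metis less_le_trans)
  with less that[of z] show ?thesis by (auto simp: divdiff_def field_simps)
next
  case greater
  then obtain z where "y < z" "z < x" "f x - f y = (x - y) * f' z"
    using MVT2[of y x f f'] f assms(3) by (metis less_le_trans)
  with greater that[of z] show ?thesis by (auto simp: divdiff_def field_simps)
qed (use that[of x] in \<open>auto simp: divdiff_def\<close>)

text \<open>Off the diagonal this is a quotient of continuous functions. Near a diagonal point the
  mean value theorem makes each value, on the diagonal or off it, a value of \<open>f'\<close> at a
  nearby point.\<close>

lemma continuous_on_divdiff:
  assumes f: "\<And>x. x > 0 \<Longrightarrow> (f has_real_derivative f' x) (at x)" and f': "continuous_on {0<..} f'"
  shows "continuous_on ({0<..} \<times> {0<..}) (\<lambda>(x, y). divdiff f f' x y)"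
  unfolding continuous_on_eq_continuous_at[OF open_Times[OF open_greaterThan open_greaterThan]]
proof safe
  fix a b :: real
  assume "a > 0" "b > 0"
  show "isCont (\<lambda>(x, y). divdiff f f' x y) (a, b)"
  proof (cases "a = b")
    case True
    have "isCont f' a"
      using f' \<open>a > 0\<close> by (simp add: continuous_on_eq_continuous_at)
    show ?thesis
      unfolding continuous_at_eps_delta
    proof (intro allI impI)
      fix e :: real
      assume "e > 0"
      then obtain d where d: "d > 0" "\<And>x. dist x a < d \<Longrightarrow> dist (f' x) (f' a) < e"
        using \<open>isCont f' a\<close> unfolding continuous_at_eps_delta by blast
      \<comment> \<open>The bound \<open>a\<close> in the minimum keeps \<open>x\<close> and
        \<open>y\<close> positive.\<close>
      have "dist (divdiff f f' x y) (f' a) < e" if "dist (x, y) (a, b) < min d a" for x y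
      proof -
        have "dist x a < min d a" "dist y a < min d a"
          using that dist_fst_le[of "(x, y)" "(a, b)"] dist_snd_le[of "(x, y)" "(a, b)"] True by auto
        then have xy: "x > 0" "y > 0" "\<bar>x - a\<bar> < d" "\<bar>y - a\<bar> < d"
          by (auto simp: dist_real_def)
        obtain z where "min x y \<le> z" "z \<le> max x y" "divdiff f f' x y = f' z"
          using divdiff_mean_value[OF f xy(1,2)] by blast
        moreover from this have "dist z a < d" using xy by (auto simp: dist_real_def)
        ultimately show ?thesis using d(2) by simp
      qed
      then show "\<exists>d>0. \<forall>z. dist z (a, b) < d \<longrightarrow>
          dist (case z of (x, y) \<Rightarrow> divdiff f f' x y) (case (a, b) of (x, y) \<Rightarrow> divdiff f f' x y) < e"
        using d(1) \<open>a > 0\<close> True by (intro exI[of _ "min d a"]) (auto simp: divdiff_def)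
    qed
  next
    case False
    have "isCont f a" "isCont f b"
      using f \<open>a > 0\<close> \<open>b > 0\<close> by (auto intro: DERIV_isCont)
    then have "isCont (\<lambda>z. f (fst z)) (a, b)" "isCont (\<lambda>z. f (snd z)) (a, b)"
      by (auto intro!: isCont_o2[of "(a, b)" fst f] isCont_o2[of "(a, b)" snd f])
    then have cont: "isCont (\<lambda>z. (f (fst z) - f (snd z)) / (fst z - snd z)) (a, b)"
      using False by (intro continuous_intros) auto
    have "\<forall>\<^sub>F z in nhds (a, b). z \<in> {z. fst z \<noteq> snd z}"
      using False by (intro eventually_nhds_in_open open_Collect_neq continuous_intros) auto
    then have ev: "\<forall>\<^sub>F z in nhds (a, b). (\<lambda>(x, y). divdiff f f' x y) z = (f (fst z) - f (snd z)) / (fst z - snd z)"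
      by eventually_elim (auto simp: divdiff_def)
    show ?thesis
      unfolding isCont_cong[OF ev] by (rule cont)
  qed
qed

lemma tendsto_dop_divdiff:
  fixes A B :: "'a \<Rightarrow> complex^'n^'n"
  assumes f: "\<And>x. x > 0 \<Longrightarrow> (f has_real_derivative f' x) (at x)" "continuous_on {0<..} f'"
    and A0: "pos_def A0" and herm: "\<And>t. hermitian_mat (A t)" "\<And>t. hermitian_mat (B t)"
    and lim: "(A \<longlongrightarrow> A0) F" "(B \<longlongrightarrow> A0) F" "(H \<longlongrightarrow> H0) F"
  shows "((\<lambda>t. dop (divdiff f f') (A t) (B t) (H t)) \<longlongrightarrow> dop (divdiff f f') A0 A0 H0) F"
proof -
  obtain m M where mM: "0 < m" "\<And>k. eigval A0 k \<in> {m..M}"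
    "\<And>(A :: 'a \<Rightarrow> complex^'n^'n) F. (A \<longlongrightarrow> A0) F \<Longrightarrow> (\<And>t. hermitian_mat (A t)) \<Longrightarrow>
      \<forall>\<^sub>F t in F. \<forall>k. eigval (A t) k \<in> {m..M}"
    using eigval_eventually_bounded[OF A0] by metis
  show ?thesis
  proof (rule tendsto_dop)
    show "continuous_on ({m..M} \<times> {m..M}) (\<lambda>(x, y). divdiff f f' x y)"
      using mM(1) by (intro continuous_on_subset[OF continuous_on_divdiff[OF f]]) auto
  qed (rule herm lim pos_def_hermitian[OF A0] mM(2)
      mM(3)[OF lim(1) herm(1)] mM(3)[OF lim(2) herm(2)])+
qed

section \<open>The Daleckii--Krein derivative\<close>

lemma has_vector_derivative_iff_difference_quotient:
  "(f has_vector_derivative D) (at x) \<longleftrightarrow> ((\<lambda>t. (1 / (t - x)) *\<^sub>R (f t - f x)) \<longlongrightarrow> D) (at x)"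
proof -
  have "norm (f t - f x - (t - x) *\<^sub>R D) / norm (t - x) = norm ((1 / (t - x)) *\<^sub>R (f t - f x) - D)"
    if "t \<noteq> x" for t
  proof -
    have "(1 / (t - x)) *\<^sub>R (f t - f x) - D = (1 / (t - x)) *\<^sub>R (f t - f x - (t - x) *\<^sub>R D)"
      using that by (simp add: scaleR_right_diff_distrib)
    then show ?thesis by simp
  qed
  then have "((\<lambda>t. norm (f t - f x - (t - x) *\<^sub>R D) / norm (t - x)) \<longlongrightarrow> 0) (at x) \<longleftrightarrow>
      ((\<lambda>t. norm ((1 / (t - x)) *\<^sub>R (f t - f x) - D)) \<longlongrightarrow> 0) (at x)"
    by (intro tendsto_cong eventually_at_filter[THEN iffD2] always_eventually) simp
  then show ?thesis
    unfolding has_vector_derivative_def has_derivative_iff_norm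
    by (simp add: bounded_linear_scaleR_left tendsto_norm_zero_iff LIM_zero_iff)
qed

definition powr_divdiff :: "real \<Rightarrow> real \<Rightarrow> real \<Rightarrow> real" where
  "powr_divdiff p = divdiff (\<lambda>x. x powr p) (\<lambda>x. p * x powr (p - 1))"

lemma powr_divdiff_commute: "powr_divdiff p x y = powr_divdiff p y x"
  by (auto simp: powr_divdiff_def divdiff_def divide_simps) (simp add: algebra_simps)

lemma has_real_derivative_powr_const:
  "x > 0 \<Longrightarrow> ((\<lambda>x. x powr p) has_real_derivative p * x powr (p - 1)) (at x)"
  by (auto intro!: derivative_eq_intros simp: powr_diff)

lemma continuous_on_powr_derivative: "continuous_on {0<..} (\<lambda>x::real. p * x powr (p - 1))"
  by (intro continuous_intros) auto

text \<open>By \<open>mat_fun_diff\<close> the difference quotient is a double operator integral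
  between \<open>A t\<close> and \<open>A s\<close>, applied to the difference quotient of
  \<open>A\<close>. Its limit is an instance of joint continuity.\<close>

theorem mat_fun_has_vector_derivative:
  assumes f: "\<And>x. x > 0 \<Longrightarrow> (f has_real_derivative f' x) (at x)" "continuous_on {0<..} f'"
    and A: "\<And>t. pos_def (A t)" and A': "(A has_vector_derivative A') (at s)"
  shows "((\<lambda>t. mat_fun f (A t)) has_vector_derivative dop (divdiff f f') (A s) (A s) A') (at s)"
proof -
  note herm = pos_def_hermitian[OF A]
  have "(A \<longlongrightarrow> A s) (at s)"
    using has_vector_derivative_continuous[OF A'] by (simp add: continuous_within)
  moreover have "((\<lambda>t. (1 / (t - s)) *\<^sub>R (A t - A s)) \<longlongrightarrow> A') (at s)"
    using A' by (simp add: has_vector_derivative_iff_difference_quotient)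
  ultimately have "((\<lambda>t. dop (divdiff f f') (A t) (A s) ((1 / (t - s)) *\<^sub>R (A t - A s))) \<longlongrightarrow>
      dop (divdiff f f') (A s) (A s) A') (at s)"
    by (intro tendsto_dop_divdiff f A herm tendsto_const)
  then show ?thesis
    unfolding has_vector_derivative_iff_difference_quotient dop_scaleR_right
    by (simp only: mat_fun_diff[OF herm herm, symmetric])
qed

lemma mat_fun_powr_has_vector_derivative:
  assumes "\<And>t. pos_def (A t)" "(A has_vector_derivative A') (at s)"
  shows "((\<lambda>t. mat_fun (\<lambda>x. x powr p) (A t)) has_vector_derivative
    dop (powr_divdiff p) (A s) (A s) A') (at s)"
  unfolding powr_divdiff_def
  by (rule mat_fun_has_vector_derivative)
    (use assms has_real_derivative_powr_const continuous_on_powr_derivative in auto)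

text \<open>Meant for the factor of the first derivative that is never differentiated: base point
  and direction move together.\<close>

lemma tendsto_dop_powr_divdiff:
  assumes "pos_def A0" "\<And>t. hermitian_mat (A t)" "(A \<longlongrightarrow> A0) F" "(H \<longlongrightarrow> H0) F"
  shows "((\<lambda>t. dop (powr_divdiff p) (A t) (A t) (H t)) \<longlongrightarrow> dop (powr_divdiff p) A0 A0 H0) F"
  unfolding powr_divdiff_def
  by (rule tendsto_dop_divdiff)
    (use assms has_real_derivative_powr_const continuous_on_powr_derivative in auto)

section \<open>A Beta integral over resolvent kernels\<close>

text \<open>The substitution \<open>t = a u / (1 - u)\<close> carries the unit interval to the
  half-line and turns \<open>a + t\<close> into \<open>a / (1 - u)\<close>; collecting powers leaves
  the Beta integrand and the factor \<open>a powr (- y)\<close>.\<close>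

lemma Beta_second_kind_integral:
  fixes a x y :: real
  assumes "a > 0" "x > 0" "y > 0"
  defines "f \<equiv> \<lambda>t. t powr (x - 1) * (a + t) powr (- (x + y))"
  shows "set_integrable lborel {0<..} f" "(LINT t:{0<..}|lborel. f t) = a powr (- y) * Beta x y"
proof -
  define g where "g = (\<lambda>u::real. a * u / (1 - u))"
  define g' where "g' = (\<lambda>u::real. a / (1 - u)\<^sup>2)"
  define h where "h = (\<lambda>u::real. u powr (x - 1) * (1 - u) powr (y - 1))"
  have int: "set_integrable lborel {0<..<1} h"
    unfolding h_def using assms by (intro set_integrable_subset[OF integrable_Beta]) auto
  have fg: "f (g u) * g' u = a powr (- y) * h u" if "0 < u" "u < 1" for u
  proof -
    define v where "v = 1 - u"
    have v: "v > 0" using that by (simp add: v_def)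
    have "a + g u = a / v" using that by (simp add: g_def v_def field_simps)
    then have "f (g u) * g' u = (a powr (x - 1) * a powr (- (x + y)) * a powr 1) * u powr (x - 1) /
        (v powr (x - 1) * v powr (- (x + y)) * v powr 2)"
      using that assms(1) v
      by (simp add: f_def g'_def g_def powr_mult powr_divide flip: v_def)
    moreover have "a powr (x - 1) * a powr (- (x + y)) * a powr 1 = a powr (- y)"
      by (simp only: powr_add[symmetric]) simp
    moreover have "v powr (y - 1) * (v powr (x - 1) * v powr (- (x + y)) * v powr 2) = 1"
      using v by (simp only: powr_add[symmetric]) simp
    then have "1 / (v powr (x - 1) * v powr (- (x + y)) * v powr 2) = v powr (y - 1)"
      by (metis divide_eq_eq mult_zero_right zero_neq_one)
    ultimately show ?thesis
      by (simp add: h_def v_def divide_inverse mult_ac)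
  qed
  have eint: "einterval 0 1 = {0<..<1}" "einterval 0 \<infinity> = {0<..}"
    by (auto simp: einterval_def zero_ereal_def one_ereal_def)
  have eq: "set_integrable lborel (einterval 0 1) (\<lambda>u. f (g u) * g' u)"
  proof -
    have "set_integrable lborel {0<..<1} (\<lambda>u. a powr (- y) * h u)"
      using int by simp
    then show ?thesis
      unfolding eint by (rule set_integrable_cong[THEN iffD1, rotated -1]) (use fg in auto)
  qed
  have interior: "DERIV g u :> g' u" "isCont f (g u)" "isCont g' u" "0 \<le> f (g u)"
    if "0 < ereal u" "ereal u < 1" for u
  proof -
    have u: "0 < u" "u < 1" using that by (auto simp: zero_ereal_def one_ereal_def)
    show "DERIV g u :> g' u"
      unfolding g_def g'_def using u
      by (auto intro!: derivative_eq_intros simp: field_simps power2_eq_square)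
    have "g u > 0" using u assms(1) by (simp add: g_def)
    then show "isCont f (g u)"
      unfolding f_def using assms(1) by (intro continuous_intros) auto
    show "isCont g' u"
      unfolding g'_def using u by (intro continuous_intros) auto
    show "0 \<le> f (g u)" by (simp add: f_def)
  qed
  have "(g \<longlongrightarrow> g 0) (at_right 0)"
    unfolding g_def by (intro tendsto_intros) auto
  then have lim0: "((ereal \<circ> g \<circ> real_of_ereal) \<longlongrightarrow> 0) (at_right 0)"
    by (simp add: zero_ereal_def ereal_tendsto_simps g_def)
  have "filterlim g at_top (at_left 1)"
    unfolding g_def using assms(1) by real_asymp
  then have lim1: "((ereal \<circ> g \<circ> real_of_ereal) \<longlongrightarrow> \<infinity>) (at_left 1)"
    by (simp add: one_ereal_def ereal_tendsto_simps)
  have g': "0 \<le> g' u" for u using assms(1) by (simp add: g'_def)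
  \<comment> \<open>For a nonnegative integrand the substitution rule yields integrability on the
    half-line as well as the value.\<close>
  note subst = interval_integral_substitution_nonneg[of 0 1 g g' f 0 \<infinity>, OF _ interior g' lim0 lim1 eq]
  show "set_integrable lborel {0<..} f"
    using subst(1) by (simp add: eint)
  have "(LINT t:{0<..}|lborel. f t) = (LBINT t=0..\<infinity>. f t)"
    by (simp add: interval_lebesgue_integral_def eint)
  also have "\<dots> = (LINT u:{0<..<1}|lborel. f (g u) * g' u)"
    by (subst subst(2)) (simp_all add: interval_lebesgue_integral_def eint)
  also have "\<dots> = (LINT u:{0<..<1}|lborel. a powr (- y) * h u)"
    by (rule set_lebesgue_integral_cong) (use fg in auto)
  also have "\<dots> = a powr (- y) * (LINT u:{0<..<1}|lborel. h u)"
    by simp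
  also have "(LINT u:{0<..<1}|lborel. h u) = Beta x y"
  proof -
    have "(h has_integral Beta x y) {0<..<1}"
      using has_integral_Beta_real[OF assms(2,3)] unfolding h_def by (simp add: has_integral_Icc_iff_Ioo)
    then show ?thesis
      using set_borel_integral_eq_integral(2)[OF int] by (simp add: integral_unique)
  qed
  finally show "(LINT t:{0<..}|lborel. f t) = a powr (- y) * Beta x y" .
qed

text \<open>The arguments add up to 1, so the denominator \<open>Gamma 1\<close> is 1 and Euler's
  reflection formula remains.\<close>

lemma Beta_reflection:
  fixes x :: real
  assumes "0 < x" "x < 1"
  shows "Beta x (1 - x) = pi / sin (x * pi)"
proof -
  have "complex_of_real (Beta x (1 - x)) = Gamma (of_real x) * Gamma (1 - of_real x)"
    by (simp add: Beta_def flip: Gamma_complex_of_real)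
  also have "\<dots> = complex_of_real (pi / sin (x * pi))"
    by (subst Gamma_reflection_complex) (simp add: mult.commute flip: sin_of_real)
  finally show ?thesis by (simp only: of_real_eq_iff)
qed

text \<open>For \<open>a \<noteq> b\<close> partial fractions produce two Beta integrals, whose
  values form the difference in the numerator of the divided difference. For \<open>a = b\<close>
  one Beta integral with first argument \<open>2 - \<alpha>\<close> remains, and its recurrence
  supplies the factor \<open>1 - \<alpha>\<close> of the derivative.\<close>

lemma resolvent_kernel_integral:
  fixes a b \<alpha> :: real
  assumes ab: "a > 0" "b > 0" and \<alpha>: "0 < \<alpha>" "\<alpha> < 1"
  defines "f \<equiv> \<lambda>t. t powr (1 - \<alpha>) * (1 / ((a + t) * (b + t)))"
  shows "set_integrable lborel {0<..} f"
    and "(LINT t:{0<..}|lborel. f t) =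
      pi / sin ((1 - \<alpha>) * pi) * powr_divdiff (1 - \<alpha>) a b"
proof -
  have B: "Beta (1 - \<alpha>) \<alpha> = pi / sin ((1 - \<alpha>) * pi)"
    using Beta_reflection[of "1 - \<alpha>"] \<alpha> by simp
  define k where "k = (\<lambda>c t. t powr (- \<alpha>) * (c + t) powr (- 1))"
  have k: "set_integrable lborel {0<..} (k c)"
    "(LINT t:{0<..}|lborel. k c t) = c powr (- \<alpha>) * Beta (1 - \<alpha>) \<alpha>" if "c > 0" for c
    using Beta_second_kind_integral[of c "1 - \<alpha>" \<alpha>] that \<alpha> by (simp_all add: k_def)
  have "set_integrable lborel {0<..} f \<and>
     (LINT t:{0<..}|lborel. f t) = Beta (1 - \<alpha>) \<alpha> *
       divdiff (\<lambda>x. x powr (1 - \<alpha>)) (\<lambda>x. (1 - \<alpha>) * x powr (- \<alpha>)) a b"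
  proof (cases "a = b")
    case True
    define k2 where "k2 = (\<lambda>t. t powr (1 - \<alpha>) * (a + t) powr (- 2))"
    have k2: "set_integrable lborel {0<..} k2"
      "(LINT t:{0<..}|lborel. k2 t) = a powr (- \<alpha>) * Beta (1 - \<alpha> + 1) \<alpha>"
      using Beta_second_kind_integral[of a "1 - \<alpha> + 1" \<alpha>] ab \<alpha> by (simp_all add: k2_def)
    have f: "f t = k2 t" if "t \<in> {0<..}" for t
      using that ab True by (simp add: f_def k2_def powr_minus_divide power2_eq_square)
    have "1 - \<alpha> \<notin> \<int>\<^sub>\<le>\<^sub>0" using \<alpha> by (auto elim!: nonpos_Ints_cases)
    then have "Beta (1 - \<alpha> + 1) \<alpha> = (1 - \<alpha>) * Beta (1 - \<alpha>) \<alpha>"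
      using Beta_plus1_left[of "1 - \<alpha>" \<alpha>] by simp
    moreover have "(LINT t:{0<..}|lborel. f t) = (LINT t:{0<..}|lborel. k2 t)"
      by (rule set_lebesgue_integral_cong) (use f in auto)
    moreover have "set_integrable lborel {0<..} f"
      using k2(1) f by (auto intro: set_integrable_cong[THEN iffD2])
    ultimately show ?thesis
      using k2(2) True by (simp add: divdiff_def)
  next
    case False
    \<comment> \<open>One factor \<open>t\<close> of the power goes into the partial fractions. Each
      summand then decays like \<open>t powr (- \<alpha> - 1)\<close> and is integrable by itself;
      splitting only the product of reciprocals would leave two divergent integrals.\<close>
    have f: "f t = (a / (a - b)) * k a t - (b / (a - b)) * k b t" if "t \<in> {0<..}" for t
    proof -
      have "t powr (1 - \<alpha>) = t * t powr (- \<alpha>)"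
        using that by (simp add: powr_diff powr_minus divide_simps)
      moreover have k_eq: "(c + t) powr (- 1) = 1 / (c + t)" if "c > 0" for c
        using that \<open>t \<in> {0<..}\<close> by (simp add: powr_minus_divide)
      moreover have "t * (1 / ((a + t) * (b + t))) = (a / (a - b)) * (1 / (a + t)) - (b / (a - b)) * (1 / (b + t))"
        using False ab that by (simp add: divide_simps) (simp add: algebra_simps)
      ultimately have "f t = t powr (- \<alpha>) * ((a / (a - b)) * (1 / (a + t)) - (b / (a - b)) * (1 / (b + t)))"
        unfolding f_def by (metis mult.assoc mult.commute)
      then show ?thesis
        unfolding k_def k_eq[OF ab(1)] k_eq[OF ab(2)] by (simp only: right_diff_distrib mult_ac)
    qed
    have i: "set_integrable lborel {0<..} (\<lambda>t. (a / (a - b)) * k a t - (b / (a - b)) * k b t)"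
      using k(1)[OF ab(1)] k(1)[OF ab(2)] by (intro set_integral_diff(1) set_integrable_mult_right) auto
    have "(LINT t:{0<..}|lborel. f t) = (LINT t:{0<..}|lborel. (a / (a - b)) * k a t - (b / (a - b)) * k b t)"
      by (rule set_lebesgue_integral_cong) (use f in auto)
    also have "\<dots> = (a / (a - b)) * (LINT t:{0<..}|lborel. k a t) - (b / (a - b)) * (LINT t:{0<..}|lborel. k b t)"
      using k(1)[OF ab(1)] k(1)[OF ab(2)] by (subst set_integral_diff(2)) auto
    also have "\<dots> = Beta (1 - \<alpha>) \<alpha> * divdiff (\<lambda>x. x powr (1 - \<alpha>)) (\<lambda>x. (1 - \<alpha>) * x powr (- \<alpha>)) a b"
    proof -
      have "c powr (1 - \<alpha>) = c * c powr (- \<alpha>)" if "c > 0" for c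
        using that by (simp add: powr_diff powr_minus divide_simps)
      then show ?thesis
        using False ab by (simp add: k divdiff_def diff_divide_distrib algebra_simps)
    qed
    finally show ?thesis
      using i f by (auto intro: set_integrable_cong[THEN iffD2])
  qed
  then show "set_integrable lborel {0<..} f"
    "(LINT t:{0<..}|lborel. f t) =
      pi / sin ((1 - \<alpha>) * pi) * powr_divdiff (1 - \<alpha>) a b"
    unfolding B powr_divdiff_def by auto
qed

section \<open>The Hessian of the sandwiched trace functional\<close>

lemma bounded_bilinear_matrix_mult:
  "bounded_bilinear ((**) :: complex^'k^'m \<Rightarrow> complex^'n^'k \<Rightarrow> complex^'n^'m)"
  unfolding bilinear_conv_bounded_bilinear[symmetric] bilinear_def
  by (auto intro!: linearI simp: matrix_add_ldistrib matrix_add_rdistrib matrix_scaleR_left matrix_scaleR_right)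

lemmas has_vector_derivative_matrix_mult =
  bounded_bilinear.has_vector_derivative[OF bounded_bilinear_matrix_mult]

lemma bounded_linear_trace: "bounded_linear (trace :: complex^'n^'n \<Rightarrow> complex)"
  unfolding linear_conv_bounded_linear[symmetric]
  by (auto intro!: linearI simp: trace_def sum.distrib scaleR_sum_right)

lemma trace_scaleR: "trace (c *\<^sub>R (A :: complex^'n^'n)) = c *\<^sub>R trace A"
  by (simp add: trace_def scaleR_sum_right)

lemma bounded_linear_Re_trace: "bounded_linear (\<lambda>A :: complex^'n^'n. Re (trace A))"
  by (rule bounded_linear_compose[OF bounded_linear_Re bounded_linear_trace])

text \<open>The left inverse \<open>D\<close> makes \<open>C\<close> injective, so the form of
  \<open>A\<close> is evaluated at a nonzero vector.\<close>

lemma pos_def_congruence: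
  fixes A C :: "complex^'n^'n"
  assumes A: "pos_def A" and C: "D ** C = mat 1"
  shows "pos_def (mat_adjoint C ** A ** C)"
  unfolding pos_def_def
proof (intro conjI allI impI)
  show "hermitian_mat (mat_adjoint C ** A ** C)"
    using pos_def_hermitian[OF A] by (simp add: hermitian_mat_def mat_adjoint_mult matrix_mul_assoc)
  fix x :: "complex^'n"
  assume "x \<noteq> 0"
  have "D *v (C *v x) = x" by (simp add: matrix_vector_mul_assoc C)
  then have "C *v x \<noteq> 0" using \<open>x \<noteq> 0\<close> by (metis matrix_vector_mult_0_right)
  moreover have "cinner x ((mat_adjoint C ** A ** C) *v x) = cinner (C *v x) (A *v (C *v x))"
    unfolding matrix_vector_mul_assoc[symmetric] cinner_mult_vec[of x "mat_adjoint C"] by simp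
  ultimately show "0 < Re (cinner x ((mat_adjoint C ** A ** C) *v x))"
    using A by (simp add: pos_def_def)
qed

lemma mat_fun_powr_mult:
  assumes "hermitian_mat A"
  shows "mat_fun (\<lambda>x. x powr p) A ** mat_fun (\<lambda>x. x powr q) A = mat_fun (\<lambda>x. x powr (p + q)) A"
  using assms by (simp add: mat_fun_mult powr_add)

text \<open>Positivity of the eigenvalues is essential, as \<open>0 powr 0 = 0\<close>.\<close>

lemma mat_fun_powr_zero:
  assumes "pos_def A"
  shows "mat_fun (\<lambda>x. x powr 0) A = mat 1"
proof -
  have "mat_fun (\<lambda>x. x powr 0) A = mat_fun (\<lambda>x. 1) A"
    using eigval_pos[OF assms] by (intro mat_fun_cong) (simp add: less_imp_neq[symmetric])
  then show ?thesis using mat_fun_const_one[OF pos_def_hermitian[OF assms]] by simp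
qed

lemma mat_fun_powr_one:
  assumes "pos_def A"
  shows "mat_fun (\<lambda>x. x powr 1) A = A"
proof -
  have "mat_fun (\<lambda>x. x powr 1) A = mat_fun (\<lambda>x. x) A"
    using eigval_pos[OF assms] by (intro mat_fun_cong) (simp add: less_imp_le)
  then show ?thesis using mat_fun_id[OF pos_def_hermitian[OF assms]] by simp
qed

lemma mat_fun_powr_inverse:
  assumes "pos_def A"
  shows "mat_fun (\<lambda>x. x powr (- p)) A ** mat_fun (\<lambda>x. x powr p) A = mat 1"
  using mat_fun_powr_mult[OF pos_def_hermitian[OF assms], of "- p" p] mat_fun_powr_zero[OF assms]
  by simp

lemma pos_def_sandwich:
  assumes "pos_def \<rho>" "pos_def \<sigma>"
  shows "pos_def (mat_fun (\<lambda>x. x powr r) \<sigma> ** \<rho> ** mat_fun (\<lambda>x. x powr r) \<sigma>)"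
  using pos_def_congruence[OF assms(1) mat_fun_powr_inverse[OF assms(2), of r]]
    hermitian_mat_fun[of "\<lambda>x. x powr r" \<sigma>] by (simp add: hermitian_mat_def)

lemma pos_def_mat_one: "pos_def (mat 1 :: complex^'n^'n)"
proof -
  have "hermitian_mat (mat 1 :: complex^'n^'n)"
    by (simp add: hermitian_mat_def mat_adjoint_def mat_def vec_eq_iff)
  then show ?thesis by (simp add: pos_def_def cinner_self)
qed

text \<open>A power is the sandwich of the identity between two half powers.\<close>

lemma pos_def_mat_fun_powr:
  assumes "pos_def A"
  shows "pos_def (mat_fun (\<lambda>x. x powr p) A)"
  using pos_def_sandwich[OF pos_def_mat_one assms, of "p / 2"]
  by (simp add: mat_fun_powr_mult pos_def_hermitian[OF assms])

lemma trace_pos_def: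
  fixes A :: "complex^'n^'n"
  assumes "pos_def A"
  shows "Re (trace A) > 0"
proof -
  have "Re (A $ k $ k) > 0" for k
  proof -
    have "cinner (axis k 1) (A *v axis k 1) = A $ k $ k"
      by (simp add: cinner_def axis_def matrix_vector_mult_def if_distrib[of "\<lambda>x. x * _"]
        if_distrib[of "\<lambda>x. _ * x"] if_distrib[of cnj] cong: if_cong)
    moreover have "axis k (1 :: complex) \<noteq> 0" by (simp add: axis_eq_0_iff)
    ultimately show ?thesis using assms by (metis pos_def_def)
  qed
  then show ?thesis by (simp add: trace_def sum_pos)
qed

section \<open>The first derivative of the sandwiched trace\<close>

lemma Re_trace_mat_fun_powr_has_derivative:
  assumes X: "\<And>t. pos_def (X t)" and X': "(X has_vector_derivative X') (at s)"
  shows "((\<lambda>t. Re (trace (mat_fun (\<lambda>x. x powr p) (X t)))) has_real_derivative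
    p * Re (trace (mat_fun (\<lambda>x. x powr (p - 1)) (X s) ** X'))) (at s)"
proof -
  note herm = pos_def_hermitian[OF X]
  have "trace (dop (powr_divdiff p) (X s) (X s) X') =
      trace (mat_fun (\<lambda>x. 1) (X s) ** dop (powr_divdiff p) (X s) (X s) X')"
    by (simp add: mat_fun_const_one herm)
  also have "\<dots> = trace (mat_fun (\<lambda>x. p * x powr (p - 1)) (X s) ** X')"
    by (simp add: trace_mat_fun_dop herm powr_divdiff_def divdiff_def)
  also have "mat_fun (\<lambda>x. p * x powr (p - 1)) (X s) = p *\<^sub>R mat_fun (\<lambda>x. x powr (p - 1)) (X s)"
    using dop_scaleR[of p "\<lambda>x y. x powr (p - 1)" "X s" "X s" "mat 1"]
    by (simp add: dop_left[where f = "\<lambda>x. p * x powr (p - 1)"] dop_left[where f = "\<lambda>x. x powr (p - 1)"] herm)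
  finally have eq: "Re (trace (dop (powr_divdiff p) (X s) (X s) X')) =
      p * Re (trace (mat_fun (\<lambda>x. x powr (p - 1)) (X s) ** X'))"
    by (simp add: matrix_scaleR_left trace_scaleR)
  show ?thesis
    unfolding has_real_derivative_iff_has_vector_derivative eq[symmetric]
    by (rule bounded_linear.has_vector_derivative[OF bounded_linear_Re_trace
        mat_fun_powr_has_vector_derivative[OF X X']])
qed

text \<open>The term in \<open>\<sigma>\<^bsup>1-r\<^esup>\<close> does not affect derivatives along curves of constant trace, and makes the
  gradient vanish at \<open>\<sigma> = \<rho>\<close>.\<close>
definition sandwich_gradient :: "real \<Rightarrow> real \<Rightarrow> complex^'n^'n \<Rightarrow> complex^'n^'n \<Rightarrow> complex^'n^'n" where
  "sandwich_gradient \<alpha> r \<rho> \<sigma> =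
    (let T = mat_fun (\<lambda>x. x powr r) \<sigma>; N = mat_fun (\<lambda>x. x powr (\<alpha> - 1)) (T ** \<rho> ** T)
     in \<rho> ** T ** N + N ** T ** \<rho> - 2 *\<^sub>R mat_fun (\<lambda>x. x powr (1 - r)) \<sigma>)"

text \<open>The derivative of the trace of a power needs only the product rule for
  \<open>T \<rho> T\<close>; cyclicity then collects both terms into one matrix multiplied by the
  derivative of \<open>T\<close>.\<close>

lemma sandwich_trace_has_derivative:
  assumes \<rho>: "pos_def \<rho>" and \<sigma>: "\<And>t. pos_def (\<sigma> t)" and S: "(\<sigma> has_vector_derivative S) (at s)"
    and tr: "trace S = 0"
  shows "((\<lambda>t. Re (trace (mat_fun (\<lambda>x. x powr \<alpha>)
      (mat_fun (\<lambda>x. x powr r) (\<sigma> t) ** \<rho> ** mat_fun (\<lambda>x. x powr r) (\<sigma> t))))) has_real_derivative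
    \<alpha> * Re (trace (sandwich_gradient \<alpha> r \<rho> (\<sigma> s) ** dop (powr_divdiff r) (\<sigma> s) (\<sigma> s) S))) (at s)"
proof -
  note herm = pos_def_hermitian[OF \<sigma>]
  define T where "T = (\<lambda>t. mat_fun (\<lambda>x. x powr r) (\<sigma> t))"
  define T' where "T' = dop (powr_divdiff r) (\<sigma> s) (\<sigma> s) S"
  define N where "N = mat_fun (\<lambda>x. x powr (\<alpha> - 1)) (T s ** \<rho> ** T s)"
  have T: "(T has_vector_derivative T') (at s)"
    unfolding T_def T'_def by (rule mat_fun_powr_has_vector_derivative[OF \<sigma> S])
  have "((\<lambda>t. T t ** \<rho> ** T t) has_vector_derivative T s ** \<rho> ** T' + T' ** \<rho> ** T s) (at s)"
    using has_vector_derivative_matrix_mult[OF has_vector_derivative_matrix_mult[OF T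
        has_vector_derivative_const] T, of \<rho>] by simp
  from Re_trace_mat_fun_powr_has_derivative[OF _ this, of \<alpha>]
  have main: "((\<lambda>t. Re (trace (mat_fun (\<lambda>x. x powr \<alpha>) (T t ** \<rho> ** T t)))) has_real_derivative
      \<alpha> * Re (trace (N ** (T s ** \<rho> ** T' + T' ** \<rho> ** T s)))) (at s)"
    using pos_def_sandwich[OF \<rho> \<sigma>] by (simp add: T_def N_def)
  \<comment> \<open>Under the trace the divided difference reduces to
    \<open>r x powr (r - 1)\<close>, and the exponent \<open>1 - r\<close> is exactly what cancels
    its power, leaving a multiple of the trace of \<open>S\<close>.\<close>
  have "trace (mat_fun (\<lambda>x. x powr (1 - r)) (\<sigma> s) ** T') =
      trace (mat_fun (\<lambda>x. x powr (1 - r) * (r * x powr (r - 1))) (\<sigma> s) ** S)"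
    unfolding T'_def by (simp add: trace_mat_fun_dop herm powr_divdiff_def divdiff_def)
  also have "mat_fun (\<lambda>x. x powr (1 - r) * (r * x powr (r - 1))) (\<sigma> s) = mat_fun (\<lambda>x. r) (\<sigma> s)"
  proof (rule mat_fun_cong)
    fix k
    have "eigval (\<sigma> s) k powr (1 - r) * eigval (\<sigma> s) k powr (r - 1) = 1"
      using eigval_pos[OF \<sigma>, of s k] by (simp flip: powr_add)
    then show "eigval (\<sigma> s) k powr (1 - r) * (r * eigval (\<sigma> s) k powr (r - 1)) = r"
      by (simp add: mult.left_commute)
  qed
  also have "\<dots> = r *\<^sub>R mat 1"
    using dop_scaleR[of r "\<lambda>x y. 1" "\<sigma> s" "\<sigma> s" "mat 1"] dop_one[OF herm herm, of s s "mat 1"]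
    by (simp add: dop_left[where f = "\<lambda>x. r"] herm)
  finally have zero: "trace (mat_fun (\<lambda>x. x powr (1 - r)) (\<sigma> s) ** T') = 0"
    using tr by (simp add: matrix_scaleR_left trace_scaleR)
  have "trace (N ** (T s ** \<rho> ** T' + T' ** \<rho> ** T s)) =
      trace (N ** T s ** \<rho> ** T') + trace (\<rho> ** T s ** N ** T')"
  proof -
    have "trace (N ** (T' ** \<rho> ** T s)) = trace (\<rho> ** T s ** N ** T')"
      by (metis matrix_mul_assoc trace_mul_sym)
    then show ?thesis
      by (simp add: matrix_add_ldistrib trace_add matrix_mul_assoc)
  qed
  also have "\<dots> = trace (sandwich_gradient \<alpha> r \<rho> (\<sigma> s) ** T')"
    using zero
    by (simp add: sandwich_gradient_def Let_def T_def N_def matrix_add_rdistrib trace_add trace_sub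
      matrix_scaleR_left trace_scaleR bounded_bilinear.diff_left[OF bounded_bilinear_matrix_mult])
  finally show ?thesis
    using main by (simp add: T_def T'_def)
qed

section \<open>The multiplier of the second derivative\<close>

lemma mat_fun_mult_dop:
  "hermitian_mat A \<Longrightarrow> mat_fun f A ** dop g A A H = dop (\<lambda>x y. f x * g x y) A A H"
  using dop_mult[of A A "\<lambda>x y. f x" g H] by (simp add: dop_left)

lemma dop_mult_mat_fun:
  "hermitian_mat A \<Longrightarrow> dop g A A H ** mat_fun f A = dop (\<lambda>x y. f y * g x y) A A H"
  using dop_mult[of A A "\<lambda>x y. f y" g H] by (simp add: dop_right)

text \<open>This is the symbol of the derivative of \<open>sandwich_gradient\<close> at \<rho>, with
  \<open>x\<close> and \<open>y\<close> eigenvalues of \<rho>. Writing \<open>T'\<close> and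
  \<open>N'\<close> for the derivatives of \<open>T\<close> and \<open>N\<close>, the three summands
  in the bracket stand for \<open>\<rho> T' N\<close>, \<open>N T' \<rho>\<close> and
  \<open>\<rho> T N' + N' T \<rho>\<close>; the square arises because \<open>N'\<close> already
  contains one factor \<open>x * x powr r + y * y powr r\<close> from the derivative of
  \<open>T \<rho> T\<close>.\<close>

definition hessian_symbol :: "real \<Rightarrow> real \<Rightarrow> real \<Rightarrow> real \<Rightarrow> real" where
  "hessian_symbol \<alpha> r x y =
    (let n = powr_divdiff (\<alpha> - 1) (x powr (1 / \<alpha>)) (y powr (1 / \<alpha>))
     in (x / y powr (2 * r) + y / x powr (2 * r) + n * (x * x powr r + y * y powr r)\<^sup>2) *
        powr_divdiff r x y - 2 * powr_divdiff (1 - r) x y)"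

lemma powr_double: "x powr (2 * r) = (x powr r)\<^sup>2" for x r :: real
  unfolding mult_2 powr_add power2_eq_square ..

text \<open>The off-diagonal case with \<open>u = x powr r\<close> and \<open>v = y powr r\<close>.
  Since \<open>1 / \<alpha> = 1 + 2 r\<close>, the eigenvalues of the sandwich are
  \<open>x * u^2\<close> and \<open>y * v^2\<close>, and everything becomes rational in four
  independent variables; with denominators cleared it is a polynomial identity.\<close>

lemma hessian_symbol_rational_identity:
  fixes x y u v :: real
  assumes "x \<noteq> y" "u \<noteq> 0" "v \<noteq> 0" "x * u\<^sup>2 \<noteq> y * v\<^sup>2"
  shows "((x / v\<^sup>2 + y / u\<^sup>2 + (1 / u\<^sup>2 - 1 / v\<^sup>2) / (x * u\<^sup>2 - y * v\<^sup>2) * (x * u + y * v)\<^sup>2) *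
      ((u - v) / (x - y)) - 2 * ((x / u - y / v) / (x - y))) * ((u - v) / (x - y)) =
    - ((u\<^sup>2 - v\<^sup>2) / (x * u\<^sup>2 - y * v\<^sup>2))"
proof -
  define d e where "d = x - y" and "e = x * u\<^sup>2 - y * v\<^sup>2"
  have nz: "d \<noteq> 0" "e \<noteq> 0" using assms by (auto simp: d_def e_def)
  have "((x / v\<^sup>2 + y / u\<^sup>2 + (1 / u\<^sup>2 - 1 / v\<^sup>2) / e * (x * u + y * v)\<^sup>2) *
      ((u - v) / d) - 2 * ((x / u - y / v) / d)) * ((u - v) / d) =
    (((x * u\<^sup>2 + y * v\<^sup>2) * e + (v\<^sup>2 - u\<^sup>2) * (x * u + y * v)\<^sup>2) * (u - v)\<^sup>2 -
      2 * (x * v - y * u) * u * v * e * (u - v)) / (u\<^sup>2 * v\<^sup>2 * d\<^sup>2 * e)"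
    using nz assms(2,3) by (simp add: divide_simps power2_eq_square) (simp add: algebra_simps)
  also have "((x * u\<^sup>2 + y * v\<^sup>2) * e + (v\<^sup>2 - u\<^sup>2) * (x * u + y * v)\<^sup>2) * (u - v)\<^sup>2 -
      2 * (x * v - y * u) * u * v * e * (u - v) = - (u\<^sup>2 - v\<^sup>2) * (u\<^sup>2 * v\<^sup>2 * d\<^sup>2)"
    unfolding d_def e_def by algebra
  also have "\<dots> / (u\<^sup>2 * v\<^sup>2 * d\<^sup>2 * e) = - ((u\<^sup>2 - v\<^sup>2) / e)"
    using nz assms(2,3) by (simp add: divide_simps)
  finally show ?thesis by (simp add: d_def e_def)
qed

text \<open>The second factor comes from the undifferentiated factor of the first derivative. Off
  the diagonal all powers are rational in \<open>x\<close>, \<open>y\<close> and their powers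
  \<open>r\<close>; on the diagonal the divided differences are derivatives and the case is computed
  separately.\<close>

lemma hessian_symbol_identity:
  assumes xy: "x > 0" "y > 0" and \<alpha>: "0 < \<alpha>" "\<alpha> < 1" and r: "r = (1 - \<alpha>) / (2 * \<alpha>)"
  shows "hessian_symbol \<alpha> r x y * powr_divdiff r x y =
    - powr_divdiff (1 - \<alpha>) (x powr (1 / \<alpha>)) (y powr (1 / \<alpha>))"
proof -
  have e: "1 / \<alpha> = 1 + 2 * r" using \<alpha> by (simp add: r field_simps)
  have pa: "z powr (1 / \<alpha>) = z * (z powr r)\<^sup>2" if "z > 0" for z
    using that unfolding e powr_add powr_double by simp
  have e1: "1 / \<alpha> * (\<alpha> - 1) = - (2 * r)" "1 / \<alpha> * (1 - \<alpha>) = 2 * r"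
    using \<alpha> by (simp_all add: r field_simps)
  show ?thesis
  proof (cases "x = y")
    case False
    then have ne: "x powr (1 / \<alpha>) \<noteq> y powr (1 / \<alpha>)"
    proof -
      have "(z powr (1 / \<alpha>)) powr \<alpha> = z" if "z > 0" for z
        using that \<alpha> by (simp add: powr_powr)
      then show ?thesis using False xy by metis
    qed
    define u v where "u = x powr r" and "v = y powr r"
    have uv: "u > 0" "v > 0" using xy by (auto simp: u_def v_def)
    have sq: "x powr (2 * r) = u\<^sup>2" "y powr (2 * r) = v\<^sup>2"
      by (simp_all add: u_def v_def powr_double)
    have p: "x powr (1 / \<alpha>) = x * u\<^sup>2" "y powr (1 / \<alpha>) = y * v\<^sup>2"
      using xy by (simp_all add: pa u_def v_def)
    have "powr_divdiff (\<alpha> - 1) (x powr (1 / \<alpha>)) (y powr (1 / \<alpha>)) =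
        (1 / u\<^sup>2 - 1 / v\<^sup>2) / (x * u\<^sup>2 - y * v\<^sup>2)"
      using ne unfolding powr_divdiff_def divdiff_def powr_powr e1 p[symmetric]
      by (simp add: powr_minus_divide sq)
    moreover have "powr_divdiff (1 - \<alpha>) (x powr (1 / \<alpha>)) (y powr (1 / \<alpha>)) =
        (u\<^sup>2 - v\<^sup>2) / (x * u\<^sup>2 - y * v\<^sup>2)"
      using ne unfolding powr_divdiff_def divdiff_def powr_powr e1 p[symmetric]
      by (simp add: sq)
    moreover have "powr_divdiff r x y = (u - v) / (x - y)"
      "powr_divdiff (1 - r) x y = (x / u - y / v) / (x - y)"
      using False xy by (simp_all add: powr_divdiff_def divdiff_def u_def v_def powr_diff)
    ultimately show ?thesis
      using hessian_symbol_rational_identity[of x y u v] False uv ne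
      by (simp add: hessian_symbol_def Let_def sq p flip: u_def v_def)
  next
    case True
    define u where "u = x powr r"
    have u: "u > 0" using xy by (auto simp: u_def)
    have sq: "x powr (2 * r) = u\<^sup>2"
      by (simp add: u_def powr_double)
    \<comment> \<open>A polynomial form of the relation between \<open>r\<close> and \<alpha>, on
      which both concluding \<open>algebra\<close> steps rest.\<close>
    have a: "\<alpha> - 1 = - (2 * r * \<alpha>)" using \<alpha> by (simp add: r field_simps)
    have "1 / \<alpha> * (\<alpha> - 1 - 1) = - (2 * (2 * r) + 1)" using \<alpha> by (simp add: r field_simps)
    moreover have "x powr (- (2 * (2 * r) + 1)) = 1 / (x * u ^ 4)"
      using xy unfolding powr_minus_divide powr_add mult_2 u_def
      by (simp add: power4_eq_xxxx mult_ac)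
    ultimately have n: "powr_divdiff (\<alpha> - 1) (x powr (1 / \<alpha>)) (x powr (1 / \<alpha>)) =
        (\<alpha> - 1) / (x * u ^ 4)"
      by (simp add: powr_divdiff_def divdiff_def powr_powr)
    have k: "powr_divdiff (1 - \<alpha>) (x powr (1 / \<alpha>)) (x powr (1 / \<alpha>)) = (1 - \<alpha>) / x"
      using xy \<alpha> by (simp add: powr_divdiff_def divdiff_def powr_powr powr_minus_divide)
    have t: "powr_divdiff r x x = r * u / x" "powr_divdiff (1 - r) x x = (1 - r) / u"
      using xy by (simp_all add: powr_divdiff_def divdiff_def u_def powr_diff powr_minus_divide)
    have "hessian_symbol \<alpha> r x x * powr_divdiff r x x =
      ((2 * x / u\<^sup>2 - 2 * r * \<alpha> / (x * u ^ 4) * (2 * x * u)\<^sup>2) * (r * u / x) - 2 * ((1 - r) / u)) * (r * u / x)"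
      unfolding hessian_symbol_def Let_def n t sq
      unfolding a u_def[symmetric] by (simp add: mult.assoc flip: mult_2)
    also have "\<dots> = (2 * r - 8 * r\<^sup>2 * \<alpha> - 2 * (1 - r)) * r / x"
      using u xy by (simp add: divide_simps power2_eq_square power4_eq_xxxx) (simp add: algebra_simps)
    also have "8 * r\<^sup>2 * \<alpha> = 4 * r * (1 - \<alpha>)"
      using a by algebra
    also have "(2 * r - 4 * r * (1 - \<alpha>) - 2 * (1 - r)) * r = - (1 - \<alpha>)"
      using a by algebra
    finally show ?thesis using True k by (simp only: minus_divide_left)
  qed
qed

lemma mat_fun_mult_left_powr:
  assumes "pos_def A"
  shows "A ** mat_fun (\<lambda>x. x powr p) A = mat_fun (\<lambda>x. x powr (1 + p)) A"
  using mat_fun_powr_mult[OF pos_def_hermitian[OF assms], of 1 p] mat_fun_powr_one[OF assms]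
  by simp

lemma mat_fun_mult_right_powr:
  assumes "pos_def A"
  shows "mat_fun (\<lambda>x. x powr p) A ** A = mat_fun (\<lambda>x. x powr (p + 1)) A"
  using mat_fun_powr_mult[OF pos_def_hermitian[OF assms], of p 1] mat_fun_powr_one[OF assms]
  by simp

lemma sandwich_self:
  assumes \<rho>: "pos_def \<rho>" and \<alpha>: "0 < \<alpha>" "\<alpha> < 1" and r: "r = (1 - \<alpha>) / (2 * \<alpha>)"
  shows "mat_fun (\<lambda>x. x powr r) \<rho> ** \<rho> ** mat_fun (\<lambda>x. x powr r) \<rho> =
    mat_fun (\<lambda>x. x powr (1 / \<alpha>)) \<rho>"
proof -
  have "r + 1 + r = 1 / \<alpha>" using \<alpha> by (simp add: r field_simps)
  then show ?thesis
    by (simp add: mat_fun_mult_right_powr[OF \<rho>] mat_fun_powr_mult pos_def_hermitian[OF \<rho>])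
qed

lemma sandwich_self_powr:
  assumes \<rho>: "pos_def \<rho>" and \<alpha>: "0 < \<alpha>" "\<alpha> < 1" and r: "r = (1 - \<alpha>) / (2 * \<alpha>)"
  shows "mat_fun (\<lambda>x. x powr (\<alpha> - 1)) (mat_fun (\<lambda>x. x powr (1 / \<alpha>)) \<rho>) =
    mat_fun (\<lambda>x. x powr (- (2 * r))) \<rho>"
proof -
  have "1 / \<alpha> * (\<alpha> - 1) = - (2 * r)" using \<alpha> by (simp add: r field_simps)
  then show ?thesis
    by (simp only: mat_fun_mat_fun[OF pos_def_hermitian[OF \<rho>]] powr_powr)
qed

text \<open>At \<rho> the factor \<open>N\<close> is the power \<open>- 2 r\<close>, so both
  products are the power \<open>1 + r - 2 r = 1 - r\<close> of \<rho>. This accounts for the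
  exponent and the factor 2 of the subtracted term.\<close>

lemma sandwich_gradient_at:
  assumes \<rho>: "pos_def \<rho>" and \<alpha>: "0 < \<alpha>" "\<alpha> < 1" and r: "r = (1 - \<alpha>) / (2 * \<alpha>)"
  shows "sandwich_gradient \<alpha> r \<rho> \<rho> = 0"
  unfolding sandwich_gradient_def Let_def sandwich_self[OF \<rho> \<alpha> r] sandwich_self_powr[OF \<rho> \<alpha> r]
  by (simp add: mat_fun_mult_left_powr[OF \<rho>] mat_fun_powr_mult pos_def_hermitian[OF \<rho>]
    mat_fun_mult_right_powr[OF \<rho>] scaleR_2)

text \<open>After the product rule each undifferentiated factor is a function of \<rho>, so all
  terms are double operator integrals over \<rho> applied to \<open>V\<close>, and their symbols can
  be added.\<close>

lemma sandwich_gradient_has_derivative: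
  assumes \<rho>: "pos_def \<rho>" and \<alpha>: "0 < \<alpha>" "\<alpha> < 1" and r: "r = (1 - \<alpha>) / (2 * \<alpha>)"
    and \<sigma>: "\<And>t. pos_def (\<sigma> t)" "\<sigma> s = \<rho>" and V: "(\<sigma> has_vector_derivative V) (at s)"
  shows "((\<lambda>t. sandwich_gradient \<alpha> r \<rho> (\<sigma> t)) has_vector_derivative
    dop (hessian_symbol \<alpha> r) \<rho> \<rho> V) (at s)"
proof -
  note herm = pos_def_hermitian[OF \<rho>]
  let ?P = "\<lambda>p. mat_fun (\<lambda>x. x powr p) \<rho>"
  define n where "n = (\<lambda>x y. powr_divdiff (\<alpha> - 1) (x powr (1 / \<alpha>)) (y powr (1 / \<alpha>)))"
  define \<tau> where "\<tau> = powr_divdiff r"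
  define T where "T = (\<lambda>t. mat_fun (\<lambda>x. x powr r) (\<sigma> t))"
  define N where "N = (\<lambda>t. mat_fun (\<lambda>x. x powr (\<alpha> - 1)) (T t ** \<rho> ** T t))"
  define T' where "T' = dop \<tau> \<rho> \<rho> V"
  define X' where "X' = T s ** \<rho> ** T' + T' ** \<rho> ** T s"
  define N' where "N' = dop n \<rho> \<rho> X'"
  have Ts: "T s = ?P r" by (simp add: T_def \<sigma>(2))
  have X: "T s ** \<rho> ** T s = ?P (1 / \<alpha>)"
    unfolding Ts by (rule sandwich_self[OF \<rho> \<alpha> r])
  have Ns: "N s = ?P (- (2 * r))"
    unfolding N_def X by (rule sandwich_self_powr[OF \<rho> \<alpha> r])
  have T: "(T has_vector_derivative T') (at s)"
    unfolding T_def T'_def \<tau>_def using mat_fun_powr_has_vector_derivative[OF \<sigma>(1) V, of r]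
    by (simp add: \<sigma>(2))
  have "((\<lambda>t. T t ** \<rho> ** T t) has_vector_derivative X') (at s)"
    using has_vector_derivative_matrix_mult[OF has_vector_derivative_matrix_mult[OF T
        has_vector_derivative_const] T, of \<rho>] by (simp add: X'_def)
  moreover have "pos_def (T t ** \<rho> ** T t)" for t
    unfolding T_def by (rule pos_def_sandwich[OF \<rho> \<sigma>(1)])
  \<comment> \<open>The integral is taken over the sandwich, a power of \<rho>;
    \<open>dop_mat_fun\<close> then expresses it over \<rho> itself, with
    \<open>1 / \<alpha>\<close> moved into the symbol \<open>n\<close>.\<close>
  ultimately have "(N has_vector_derivative dop (powr_divdiff (\<alpha> - 1)) (?P (1 / \<alpha>)) (?P (1 / \<alpha>)) X') (at s)"
    unfolding N_def X[symmetric] by (intro mat_fun_powr_has_vector_derivative)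
  then have N: "(N has_vector_derivative N') (at s)"
    by (simp add: N'_def n_def dop_mat_fun herm)
  have G: "((\<lambda>t. mat_fun (\<lambda>x. x powr (1 - r)) (\<sigma> t)) has_vector_derivative
      dop (powr_divdiff (1 - r)) \<rho> \<rho> V) (at s)"
    using mat_fun_powr_has_vector_derivative[OF \<sigma>(1) V, of "1 - r"] by (simp add: \<sigma>(2))
  have "((\<lambda>t. \<rho> ** T t ** N t + N t ** T t ** \<rho> - 2 *\<^sub>R mat_fun (\<lambda>x. x powr (1 - r)) (\<sigma> t))
      has_vector_derivative (\<rho> ** T s ** N' + \<rho> ** T' ** N s) + (N s ** T' + N' ** T s) ** \<rho> -
        2 *\<^sub>R dop (powr_divdiff (1 - r)) \<rho> \<rho> V) (at s)"
    by (intro has_vector_derivative_diff has_vector_derivative_add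
        bounded_linear.has_vector_derivative[OF bounded_linear_scaleR_right] G
        has_vector_derivative_eq_rhs[OF has_vector_derivative_matrix_mult[OF
          has_vector_derivative_matrix_mult[OF has_vector_derivative_const T] N]]
        has_vector_derivative_eq_rhs[OF has_vector_derivative_matrix_mult[OF
          has_vector_derivative_matrix_mult[OF N T] has_vector_derivative_const]]) simp_all
  also have "(\<lambda>t. \<rho> ** T t ** N t + N t ** T t ** \<rho> - 2 *\<^sub>R mat_fun (\<lambda>x. x powr (1 - r)) (\<sigma> t)) =
      (\<lambda>t. sandwich_gradient \<alpha> r \<rho> (\<sigma> t))"
    by (simp add: sandwich_gradient_def Let_def T_def N_def)
  also have "(\<rho> ** T s ** N' + \<rho> ** T' ** N s) + (N s ** T' + N' ** T s) ** \<rho> -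
        2 *\<^sub>R dop (powr_divdiff (1 - r)) \<rho> \<rho> V = dop (hessian_symbol \<alpha> r) \<rho> \<rho> V"
  proof -
    have X'_eq: "X' = dop (\<lambda>x y. x powr (r + 1) * \<tau> x y + y powr (1 + r) * \<tau> x y) \<rho> \<rho> V"
      unfolding X'_def Ts T'_def mat_fun_mult_right_powr[OF \<rho>] mat_fun_mult_dop[OF herm] dop_add
      by (simp add: mat_fun_mult_left_powr[OF \<rho>] dop_mult_mat_fun[OF herm] flip: matrix_mul_assoc)
    have N'_eq: "N' = dop (\<lambda>x y. n x y * (x powr (r + 1) * \<tau> x y + y powr (1 + r) * \<tau> x y)) \<rho> \<rho> V"
      unfolding N'_def X'_eq by (rule dop_mult[OF herm herm])
    have "\<rho> ** T s ** N' = dop (\<lambda>x y. x powr (1 + r) *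
        (n x y * (x powr (r + 1) * \<tau> x y + y powr (1 + r) * \<tau> x y))) \<rho> \<rho> V"
      by (simp add: N'_eq Ts mat_fun_mult_left_powr[OF \<rho>] mat_fun_mult_dop[OF herm])
    \<comment> \<open>Here \<rho> is read as its own first power, so that the multiplication rule
      for functions of \<rho> applies to it.\<close>
    moreover have "\<rho> ** T' ** N s = dop (\<lambda>x y. y powr (- (2 * r)) * (x powr 1 * \<tau> x y)) \<rho> \<rho> V"
      unfolding T'_def Ns mat_fun_mult_dop[OF herm, of "\<lambda>x. x powr 1", unfolded mat_fun_powr_one[OF \<rho>]]
        dop_mult_mat_fun[OF herm] ..
    moreover have "N s ** T' ** \<rho> = dop (\<lambda>x y. y powr 1 * (x powr (- (2 * r)) * \<tau> x y)) \<rho> \<rho> V"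
      unfolding T'_def Ns mat_fun_mult_dop[OF herm]
        dop_mult_mat_fun[OF herm, where f = "\<lambda>x. x powr 1", unfolded mat_fun_powr_one[OF \<rho>]] ..
    moreover have "N' ** T s ** \<rho> = dop (\<lambda>x y. y powr (r + 1) *
        (n x y * (x powr (r + 1) * \<tau> x y + y powr (1 + r) * \<tau> x y))) \<rho> \<rho> V"
      unfolding Ts matrix_mul_assoc[symmetric] mat_fun_mult_right_powr[OF \<rho>]
      unfolding N'_eq dop_mult_mat_fun[OF herm] ..
    ultimately have "(\<rho> ** T s ** N' + \<rho> ** T' ** N s) + (N s ** T' + N' ** T s) ** \<rho> -
        2 *\<^sub>R dop (powr_divdiff (1 - r)) \<rho> \<rho> V =
      dop (\<lambda>x y. (x powr (1 + r) * (n x y * (x powr (r + 1) * \<tau> x y + y powr (1 + r) * \<tau> x y)) +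
          y powr (- (2 * r)) * (x powr 1 * \<tau> x y)) +
        (y powr 1 * (x powr (- (2 * r)) * \<tau> x y) +
          y powr (r + 1) * (n x y * (x powr (r + 1) * \<tau> x y + y powr (1 + r) * \<tau> x y))) -
        2 * powr_divdiff (1 - r) x y) \<rho> \<rho> V"
      by (simp only: dop_add dop_diff dop_scaleR matrix_add_rdistrib)
    also have "\<dots> = dop (hessian_symbol \<alpha> r) \<rho> \<rho> V"
    proof (rule dop_cong)
      fix k l
      define x y where "x = eigval \<rho> k" and "y = eigval \<rho> l"
      have "x > 0" "y > 0" using eigval_pos[OF \<rho>] by (auto simp: x_def y_def)
      then have p: "x powr (1 + r) = x * x powr r" "x powr (r + 1) = x * x powr r"
        "y powr (1 + r) = y * y powr r" "y powr (r + 1) = y * y powr r" "x powr 1 = x" "y powr 1 = y"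
        by (simp_all add: powr_add)
      show "(x powr (1 + r) * (n x y * (x powr (r + 1) * \<tau> x y + y powr (1 + r) * \<tau> x y)) +
          y powr (- (2 * r)) * (x powr 1 * \<tau> x y)) +
        (y powr 1 * (x powr (- (2 * r)) * \<tau> x y) +
          y powr (r + 1) * (n x y * (x powr (r + 1) * \<tau> x y + y powr (1 + r) * \<tau> x y))) -
        2 * powr_divdiff (1 - r) x y = hessian_symbol \<alpha> r x y"
        unfolding p powr_minus_divide hessian_symbol_def Let_def \<tau>_def[symmetric]
        by (simp add: n_def algebra_simps power2_eq_square add_divide_distrib)
    qed
    finally show ?thesis .
  qed
  finally show ?thesis .
qed

section \<open>Resolvents and their trace integral\<close>

lemma matrix_inv_unique:
  assumes "A ** B = mat 1" "B ** A = mat 1"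
  shows "matrix_inv A = B"
proof -
  have "A ** matrix_inv A = mat 1"
    unfolding matrix_inv_def using someI[of "\<lambda>B. A ** B = mat 1 \<and> B ** A = mat 1" B] assms by blast
  then show ?thesis by (metis assms(2) matrix_mul_assoc matrix_mul_lid matrix_mul_rid)
qed

lemma resolvent_eq_mat_fun:
  assumes A: "pos_def A" and "t > 0"
  shows "matrix_inv (mat_powr A p + t *\<^sub>R mat 1) = mat_fun (\<lambda>x. 1 / (x powr p + t)) A"
proof -
  note herm = pos_def_hermitian[OF A]
  have "mat_fun (\<lambda>x. x powr p + t) A = dop (\<lambda>x y. x powr p + t * 1) A A (mat 1)"
    by (simp add: dop_left[where f = "\<lambda>x. x powr p + t"] herm)
  also have "\<dots> = mat_powr A p + t *\<^sub>R mat 1"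
    unfolding dop_add dop_scaleR
    by (simp add: dop_one dop_left[where f = "\<lambda>x. x powr p"] herm mat_powr_eq_mat_fun)
  finally have eq: "mat_powr A p + t *\<^sub>R mat 1 = mat_fun (\<lambda>x. x powr p + t) A" ..
  have nz: "x powr p + t \<noteq> 0" for x
    using \<open>t > 0\<close> by (smt (verit) powr_ge_zero)
  show ?thesis
    unfolding eq by (rule matrix_inv_unique) (simp_all add: mat_fun_mult herm nz mat_fun_const_one)
qed

text \<open>In an eigenbasis the integrand is a finite sum of scalar resolvent kernels with complex
  coefficients independent of \<open>t\<close>, so integrability and value are obtained term by
  term.\<close>

lemma resolvent_trace_integral:
  fixes A V W :: "complex^'n^'n"
  assumes A: "pos_def A" and \<alpha>: "0 < \<alpha>" "\<alpha> < 1"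
  defines "R \<equiv> \<lambda>t. matrix_inv (mat_powr A (1 / \<alpha>) + t *\<^sub>R mat 1)"
  defines "f \<equiv> \<lambda>t. complex_of_real (t powr (1 - \<alpha>)) * trace (R t ** V ** R t ** W)"
  shows "set_integrable lborel {0<..} f"
    and "(LINT t:{0<..}|lborel. f t) = complex_of_real (pi / sin ((1 - \<alpha>) * pi)) *
      trace (dop (\<lambda>x y. powr_divdiff (1 - \<alpha>) (x powr (1 / \<alpha>)) (y powr (1 / \<alpha>))) A A V ** W)"
proof -
  note herm = pos_def_hermitian[OF A]
  define a where "a = (\<lambda>k. eigval A k powr (1 / \<alpha>))"
  have a: "a k > 0" for k using eigval_pos[OF A, of k] by (simp add: a_def)
  define c where "c = (\<lambda>k l. (mat_adjoint (eigvec A) ** V ** eigvec A) $ k $ l *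
    (mat_adjoint (eigvec A) ** W ** eigvec A) $ l $ k)"
  define g where "g = (\<lambda>k l t. t powr (1 - \<alpha>) * (1 / ((a k + t) * (a l + t))))"
  have g: "set_integrable lborel {0<..} (g k l)" "(LINT t:{0<..}|lborel. g k l t) =
      pi / sin ((1 - \<alpha>) * pi) * powr_divdiff (1 - \<alpha>) (a k) (a l)" for k l
    unfolding g_def by (rule resolvent_kernel_integral[OF a a \<alpha>])+
  have f: "f t = (\<Sum>k\<in>UNIV. \<Sum>l\<in>UNIV. g k l t *\<^sub>R c k l)" if "t \<in> {0<..}" for t
  proof -
    have R: "R t = mat_fun (\<lambda>x. 1 / (x powr (1 / \<alpha>) + t)) A"
      using that by (simp add: R_def resolvent_eq_mat_fun[OF A])
    have "R t ** V ** R t = dop (\<lambda>x y. 1 / (y powr (1 / \<alpha>) + t) * (1 / (x powr (1 / \<alpha>) + t))) A A V"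
      unfolding R dop_left[OF herm herm, symmetric] dop_mult_mat_fun[OF herm] ..
    then show ?thesis
      by (simp add: f_def trace_dop_mult[OF herm] g_def c_def a_def sum_distrib_left scaleR_conv_of_real mult_ac)
  qed
  have i: "set_integrable lborel {0<..} (\<lambda>t. g k l t *\<^sub>R c k l)" for k l
    using integrable_scaleR_left[of "c k l" lborel "\<lambda>t. indicator {0<..} t *\<^sub>R g k l t"] g(1)[of k l]
    unfolding set_integrable_def by (simp only: scaleR_scaleR real_scaleR_def)
  have v: "(LINT t:{0<..}|lborel. g k l t *\<^sub>R c k l) =
      (pi / sin ((1 - \<alpha>) * pi) * powr_divdiff (1 - \<alpha>) (a k) (a l)) *\<^sub>R c k l" for k l
    using g(2)[of k l] integral_scaleR_left[of "c k l" lborel "\<lambda>t. indicator {0<..} t *\<^sub>R g k l t"]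
      g(1)[of k l]
    unfolding set_lebesgue_integral_def set_integrable_def by (simp only: scaleR_scaleR real_scaleR_def)
  have i2: "set_integrable lborel {0<..} (\<lambda>t. \<Sum>k\<in>UNIV. \<Sum>l\<in>UNIV. g k l t *\<^sub>R c k l)"
    using i unfolding set_integrable_def scaleR_sum_right by (intro Bochner_Integration.integrable_sum) auto
  then show "set_integrable lborel {0<..} f"
    using f by (auto intro: set_integrable_cong[THEN iffD2])
  have "(LINT t:{0<..}|lborel. f t) = (LINT t:{0<..}|lborel. \<Sum>k\<in>UNIV. \<Sum>l\<in>UNIV. g k l t *\<^sub>R c k l)"
    by (rule set_lebesgue_integral_cong) (use f in auto)
  also have "\<dots> = (\<Sum>k\<in>UNIV. \<Sum>l\<in>UNIV. LINT t:{0<..}|lborel. g k l t *\<^sub>R c k l)"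
    using i unfolding set_lebesgue_integral_def set_integrable_def scaleR_sum_right
    by (subst Bochner_Integration.integral_sum, force)+ simp
  also have "\<dots> = complex_of_real (pi / sin ((1 - \<alpha>) * pi)) *
      trace (dop (\<lambda>x y. powr_divdiff (1 - \<alpha>) (x powr (1 / \<alpha>)) (y powr (1 / \<alpha>))) A A V ** W)"
    unfolding v trace_dop_mult[OF herm] sum_distrib_left
    by (simp add: c_def a_def scaleR_conv_of_real mult_ac)
  finally show "(LINT t:{0<..}|lborel. f t) = complex_of_real (pi / sin ((1 - \<alpha>) * pi)) *
      trace (dop (\<lambda>x y. powr_divdiff (1 - \<alpha>) (x powr (1 / \<alpha>)) (y powr (1 / \<alpha>))) A A V ** W)" .
qed

lemma mat_adjoint_schur: "mat_adjoint (schur g d e X) = schur (\<lambda>x y. g y x) e d (mat_adjoint X)"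
  by (simp add: mat_adjoint_def schur_def vec_eq_iff)

lemma mat_adjoint_dop: "mat_adjoint (dop g A B H) = dop (\<lambda>x y. g y x) B A (mat_adjoint H)"
  by (simp add: dop_def mat_adjoint_schur mat_adjoint_mult matrix_mul_assoc)

lemma trace_mat_adjoint: "trace (mat_adjoint A) = cnj (trace A)"
  by (simp add: trace_def mat_adjoint_def)

text \<open>Taking adjoints reverses the product, which cyclicity undoes under the trace. This joins
  the real information matrix to the complex integral.\<close>

lemma trace_dop_mult_real:
  assumes A: "hermitian_mat A" and VW: "hermitian_mat V" "hermitian_mat W"
    and g: "\<And>x y. g x y = g y x"
  shows "complex_of_real (Re (trace (dop g A A V ** W))) = trace (dop g A A V ** W)"
proof -
  have "mat_adjoint (dop g A A V ** W) = W ** dop g A A V"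
    using VW g by (simp add: mat_adjoint_mult mat_adjoint_dop hermitian_mat_def)
  then have "cnj (trace (dop g A A V ** W)) = trace (dop g A A V ** W)"
    by (metis trace_mat_adjoint trace_mul_sym)
  then show ?thesis by (metis Reals_cnj_iff of_real_Re)
qed

text \<open>As \<open>Z s = 0\<close>, the difference quotient of the product is that of
  \<open>Z\<close> times \<open>Y t\<close>, so a limit of \<open>Y\<close> is enough.\<close>

lemma has_vector_derivative_mult_vanishing:
  fixes Z :: "real \<Rightarrow> complex^'k^'m" and Y :: "real \<Rightarrow> complex^'n^'k"
  assumes "(Z has_vector_derivative Z') (at s)" "Z s = 0" "(Y \<longlongrightarrow> Y0) (at s)"
  shows "((\<lambda>t. Z t ** Y t) has_vector_derivative Z' ** Y0) (at s)"
proof -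
  have "((\<lambda>t. ((1 / (t - s)) *\<^sub>R (Z t - Z s)) ** Y t) \<longlongrightarrow> Z' ** Y0) (at s)"
    using assms by (intro tendsto_matrix_mult) (auto simp: has_vector_derivative_iff_difference_quotient)
  then show ?thesis
    unfolding has_vector_derivative_iff_difference_quotient
    by (simp add: assms(2) matrix_scaleR_left)
qed

lemma bounded_linear_mat_adjoint: "bounded_linear (mat_adjoint :: complex^'n^'m \<Rightarrow> complex^'m^'n)"
  unfolding linear_conv_bounded_linear[symmetric]
  by (auto intro!: linearI simp: mat_adjoint_def vec_eq_iff)

section \<open>The information matrix along coordinate lines\<close>

theorem proposition22:
  fixes \<rho> :: "real^'l \<Rightarrow> complex^'n^'n"
    and \<theta> :: "real^'l" and \<alpha> :: real and i j :: 'l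
  assumes "\<And>\<eta>. quantum_state (\<rho> \<eta>)" and "\<And>\<eta>. pos_def (\<rho> \<eta>)"
    and "twice_differentiable \<rho>"
    and "0 < \<alpha>" and "\<alpha> < 1"
  shows "let R = \<lambda>t::real. matrix_inv (mat_powr (\<rho> \<theta>) (1 / \<alpha>) + t *\<^sub>R mat 1);
             f = \<lambda>t::real. complex_of_real (t powr (1 - \<alpha>)) *
                   trace (R t ** partial_deriv i \<rho> \<theta> ** R t ** partial_deriv j \<rho> \<theta>)
         in set_integrable lborel {0<..} f \<and>
            complex_of_real (sandwiched_renyi_info \<alpha> \<rho> \<theta> $ i $ j) =
              complex_of_real (sin ((1 - \<alpha>) * pi) / ((1 - \<alpha>) * pi)) *
              (LINT t:{0<..}|lborel. f t)"
proof -
  note \<rho> = assms(2) and \<alpha> = assms(4,5)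
  note herm = pos_def_hermitian[OF \<rho>]
  define r where "r = (1 - \<alpha>) / (2 * \<alpha>)"
  obtain \<rho>' where \<rho>': "\<And>x. (\<rho> has_derivative blinfun_apply (\<rho>' x)) (at x)"
    "\<And>x. \<rho>' differentiable (at x)"
    using assms(3) unfolding twice_differentiable_def by blast
  define S where "S = (\<lambda>k x. blinfun_apply (\<rho>' x) (axis k 1))"
  have line: "((\<lambda>s. \<rho> (x + s *\<^sub>R axis k 1)) has_vector_derivative S k x) (at 0)" for x k
  proof -
    have "((\<lambda>s. x + s *\<^sub>R axis k 1) has_derivative (\<lambda>s. s *\<^sub>R axis k 1)) (at 0)"
      by (auto intro!: derivative_eq_intros)
    from has_derivative_compose[OF this, of \<rho> "blinfun_apply (\<rho>' x)"] \<rho>'(1)[of x] show ?thesis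
      by (simp add: has_vector_derivative_def S_def blinfun.scaleR_right)
  qed
  have partial: "partial_deriv k \<rho> x = S k x" for k x
    unfolding partial_deriv_def by (rule vector_derivative_at[OF line])
  \<comment> \<open>A curve of Hermitian matrices equals its adjoint curve, so uniqueness of
    derivatives makes the velocity Hermitian.\<close>
  have hermS: "hermitian_mat (S k x)" for k x
    using bounded_linear.has_vector_derivative[OF bounded_linear_mat_adjoint line[of x k]]
      herm line[of x k] unfolding hermitian_mat_def by (simp add: vector_derivative_unique_at)
  \<comment> \<open>States have constant trace 1; hence the correction term in the gradient
    contributes nothing along any coordinate line.\<close>
  have trS: "trace (S k x) = 0" for k x
  proof -
    have "((\<lambda>s. 1) has_vector_derivative trace (S k x)) (at 0)"
      using bounded_linear.has_vector_derivative[OF bounded_linear_trace line[of x k]] assms(1)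
      by (simp add: quantum_state_def)
    then show ?thesis using vector_derivative_unique_at has_vector_derivative_const by blast
  qed
  define G where "G = (\<lambda>\<epsilon>. sandwich_gradient \<alpha> r (\<rho> \<theta>) (\<rho> (\<theta> + \<epsilon>)))"
  define Y where "Y = (\<lambda>k \<epsilon>. dop (powr_divdiff r) (\<rho> (\<theta> + \<epsilon>)) (\<rho> (\<theta> + \<epsilon>)) (S k (\<theta> + \<epsilon>)))"
  define q where "q = (\<lambda>\<epsilon>. Re (trace (mat_fun (\<lambda>x. x powr \<alpha>)
    (mat_fun (\<lambda>x. x powr r) (\<rho> (\<theta> + \<epsilon>)) ** \<rho> \<theta> ** mat_fun (\<lambda>x. x powr r) (\<rho> (\<theta> + \<epsilon>))))))"
  define h where "h = (\<lambda>k \<epsilon>. \<alpha> * Re (trace (G \<epsilon> ** Y k \<epsilon>)))"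
  have q_pos: "q \<epsilon> > 0" for \<epsilon>
    unfolding q_def by (intro trace_pos_def pos_def_mat_fun_powr pos_def_sandwich \<rho>)
  have q_deriv: "((\<lambda>s. q (\<epsilon> + s *\<^sub>R axis k 1)) has_real_derivative h k \<epsilon>) (at 0)" for k \<epsilon>
    using sandwich_trace_has_derivative[OF \<rho>[of \<theta>] \<rho> line[of "\<theta> + \<epsilon>" k] trS, of \<alpha> r]
    by (simp add: q_def h_def G_def Y_def add.assoc)
  have renyi: "sandwiched_renyi \<alpha> (\<rho> \<theta>) (\<rho> (\<theta> + \<epsilon>)) = 1 / (\<alpha> - 1) * ln (q \<epsilon>)" for \<epsilon>
    unfolding sandwiched_renyi_def q_def r_def[symmetric]
    by (simp add: mat_powr_eq_mat_fun herm pos_def_hermitian[OF pos_def_sandwich[OF \<rho> \<rho>]])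
  \<comment> \<open>The formula is proved at every \<open>\<epsilon>\<close>, because the outer
    partial derivative differentiates it as a function of \<open>\<epsilon>\<close>.\<close>
  have first: "partial_deriv k (\<lambda>\<epsilon>. sandwiched_renyi \<alpha> (\<rho> \<theta>) (\<rho> (\<theta> + \<epsilon>))) \<epsilon> =
      1 / (\<alpha> - 1) * (h k \<epsilon> / q \<epsilon>)" for k \<epsilon>
  proof -
    have "((\<lambda>s. 1 / (\<alpha> - 1) * ln (q (\<epsilon> + s *\<^sub>R axis k 1))) has_real_derivative
        1 / (\<alpha> - 1) * (h k \<epsilon> / q \<epsilon>)) (at 0)"
      by (intro DERIV_cmult DERIV_cong[OF DERIV_chain2[OF DERIV_ln_divide q_deriv]])
        (use q_pos in auto)
    then show ?thesis
      unfolding partial_deriv_def renyi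
      by (intro vector_derivative_at) (simp only: has_real_derivative_iff_has_vector_derivative)
  qed
  have curve0: "((\<lambda>s. \<rho> (\<theta> + s *\<^sub>R axis i 1)) has_vector_derivative S i \<theta>) (at 0)"
    by (rule line)
  have G0: "G 0 = 0"
    unfolding G_def using sandwich_gradient_at[OF \<rho> \<alpha> r_def] by simp
  have G_deriv: "((\<lambda>s. G (s *\<^sub>R axis i 1)) has_vector_derivative
      dop (hessian_symbol \<alpha> r) (\<rho> \<theta>) (\<rho> \<theta>) (S i \<theta>)) (at 0)"
    unfolding G_def by (rule sandwich_gradient_has_derivative[OF \<rho> \<alpha> r_def \<rho> _ curve0]) simp
  \<comment> \<open>Second-order differentiability enters here, through continuity of the derivative
    of the family.\<close>
  have Y_lim: "((\<lambda>s. Y j (s *\<^sub>R axis i 1)) \<longlongrightarrow> Y j 0) (at 0)"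
  proof -
    have l: "((\<lambda>s. \<theta> + s *\<^sub>R axis i (1::real)) \<longlongrightarrow> \<theta>) (at 0)"
      by (auto intro!: tendsto_eq_intros)
    have "isCont \<rho>' \<theta>" "isCont \<rho> \<theta>"
      using \<rho>' by (auto intro: differentiable_imp_continuous_within has_derivative_continuous)
    then have "((\<lambda>s. \<rho>' (\<theta> + s *\<^sub>R axis i 1)) \<longlongrightarrow> \<rho>' \<theta>) (at 0)"
      "((\<lambda>s. \<rho> (\<theta> + s *\<^sub>R axis i 1)) \<longlongrightarrow> \<rho> \<theta>) (at 0)"
      using isCont_tendsto_compose[OF _ l] by blast+
    then show ?thesis
      unfolding Y_def S_def using \<rho> herm
      by (auto intro!: tendsto_dop_powr_divdiff blinfun.tendsto tendsto_const)
  qed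
  define d where "d = \<alpha> * Re (trace (dop (hessian_symbol \<alpha> r) (\<rho> \<theta>) (\<rho> \<theta>) (S i \<theta>) ** Y j 0))"
  have h_deriv: "((\<lambda>s. h j (s *\<^sub>R axis i 1)) has_real_derivative d) (at 0)"
    unfolding h_def d_def
    by (intro DERIV_cmult, unfold has_real_derivative_iff_has_vector_derivative)
      (rule bounded_linear.has_vector_derivative[OF bounded_linear_Re_trace
        has_vector_derivative_mult_vanishing[OF G_deriv _ Y_lim]], simp add: G0)
  \<comment> \<open>At \<open>\<epsilon> = 0\<close> the power \<alpha> undoes the power
    \<open>1 / \<alpha>\<close> of the sandwich, so the trace is that of a state. With
    \<open>h j 0 = 0\<close> below, the quotient rule for \<open>h j / q\<close> then reduces to the
    derivative \<open>d\<close> of \<open>h j\<close>.\<close>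
  have q0: "q 0 = 1"
  proof -
    have "mat_fun (\<lambda>x. x powr \<alpha>) (mat_fun (\<lambda>x. x powr (1 / \<alpha>)) (\<rho> \<theta>)) = \<rho> \<theta>"
      using \<alpha> mat_fun_powr_one[OF \<rho>] by (simp add: mat_fun_mat_fun herm powr_powr)
    then show ?thesis
      using assms(1)[of \<theta>] sandwich_self[OF \<rho> \<alpha> r_def, of \<theta>] by (simp add: q_def quantum_state_def)
  qed
  have h0: "h j 0 = 0" by (simp add: h_def G0 trace_def)
  have second: "partial_deriv i (partial_deriv j (\<lambda>\<epsilon>. sandwiched_renyi \<alpha> (\<rho> \<theta>) (\<rho> (\<theta> + \<epsilon>)))) 0 =
      1 / (\<alpha> - 1) * d"
  proof -
    have "((\<lambda>s. 1 / (\<alpha> - 1) * (h j (s *\<^sub>R axis i 1) / q (s *\<^sub>R axis i 1))) has_real_derivative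
        1 / (\<alpha> - 1) * d) (at 0)"
      using q_deriv[of 0 i]
      by (intro DERIV_cmult DERIV_cong[OF DERIV_divide[OF h_deriv]]) (auto simp: q0 h0)
    then show ?thesis
      unfolding partial_deriv_def[of i] first
      by (intro vector_derivative_at) (simp add: has_real_derivative_iff_has_vector_derivative)
  qed
  define \<kappa> where "\<kappa> = (\<lambda>x y. powr_divdiff (1 - \<alpha>) (x powr (1 / \<alpha>)) (y powr (1 / \<alpha>)))"
  have \<kappa>_commute: "\<kappa> x y = \<kappa> y x" for x y by (simp add: \<kappa>_def powr_divdiff_commute)
  have "trace (dop (hessian_symbol \<alpha> r) (\<rho> \<theta>) (\<rho> \<theta>) (S i \<theta>) ** Y j 0) =
      trace (dop (\<lambda>x y. hessian_symbol \<alpha> r x y * powr_divdiff r x y) (\<rho> \<theta>) (\<rho> \<theta>) (S i \<theta>) ** S j \<theta>)"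
    unfolding Y_def by (simp add: trace_dop_mult_dop[OF herm powr_divdiff_commute])
  also have "dop (\<lambda>x y. hessian_symbol \<alpha> r x y * powr_divdiff r x y) (\<rho> \<theta>) (\<rho> \<theta>) (S i \<theta>) =
      dop (\<lambda>x y. (-1) * \<kappa> x y) (\<rho> \<theta>) (\<rho> \<theta>) (S i \<theta>)"
    using hessian_symbol_identity[OF eigval_pos[OF \<rho>] eigval_pos[OF \<rho>] \<alpha> r_def]
    by (intro dop_cong) (simp add: \<kappa>_def)
  also have "trace (\<dots> ** S j \<theta>) = - trace (dop \<kappa> (\<rho> \<theta>) (\<rho> \<theta>) (S i \<theta>) ** S j \<theta>)"
    unfolding dop_scaleR matrix_scaleR_left trace_scaleR by simp
  finally have d: "d = - \<alpha> * Re (trace (dop \<kappa> (\<rho> \<theta>) (\<rho> \<theta>) (S i \<theta>) ** S j \<theta>))"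
    by (simp add: d_def)
  \<comment> \<open>The constants multiply to \<open>1 / \<alpha>\<close> times
    \<open>1 / (\<alpha> - 1)\<close> times \<open>- \<alpha>\<close>, which is
    \<open>1 / (1 - \<alpha>)\<close>.\<close>
  have "sandwiched_renyi_info \<alpha> \<rho> \<theta> $ i $ j =
      1 / (1 - \<alpha>) * Re (trace (dop \<kappa> (\<rho> \<theta>) (\<rho> \<theta>) (S i \<theta>) ** S j \<theta>))"
    using \<alpha> by (simp add: sandwiched_renyi_info_def second d divide_simps) (simp add: algebra_simps)
  then have info: "complex_of_real (sandwiched_renyi_info \<alpha> \<rho> \<theta> $ i $ j) =
      complex_of_real (1 / (1 - \<alpha>)) * trace (dop \<kappa> (\<rho> \<theta>) (\<rho> \<theta>) (S i \<theta>) ** S j \<theta>)"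
    by (simp only: of_real_mult trace_dop_mult_real[OF herm hermS hermS \<kappa>_commute])
  \<comment> \<open>The prefactor of the integral is \<open>1 / (1 - \<alpha>)\<close> divided by
    the Beta constant of the resolvent integral; positivity of the sine permits this split.\<close>
  have "sin ((1 - \<alpha>) * pi) > 0" using \<alpha> by (intro sin_gt_zero) auto
  then have const: "1 / (1 - \<alpha>) = sin ((1 - \<alpha>) * pi) / ((1 - \<alpha>) * pi) * (pi / sin ((1 - \<alpha>) * pi))"
    using \<alpha> by (simp add: divide_simps)
  show ?thesis
    unfolding Let_def partial info const
    using resolvent_trace_integral[OF \<rho>[of \<theta>] \<alpha>, of "S i \<theta>" "S j \<theta>"]
    by (simp only: \<kappa>_def of_real_mult mult.assoc)
qed

end
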